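(* Let $p, q$ be integers with $p, q \geq 1$ and $p+q \geq 4$, and let $G = H_3 \times \mathbb{R}^{p+q-3}$. Then the number of equivalence classes, up to scaling and automorphisms, of left-invariant pseudo-Riemannian metrics of signature $(p,q)$ on $G$ is: (1) $21$ if $p, q \geq 3$; (2) $15$ if $p \geq 3$ and $q = 2$; (3) $6$ if $p \geq 3$ and $q = 1$; (4) $10$ if $p = q = 2$.
   Context: $H_3$ denotes the three-dimensional (connected, simply-connected) Heisenberg group. A pseudo-Riemannian metric has signature $(p,q)$ if the induced nondegenerate symmetric bilinear form on each tangent space has $p$ positive and $q$ negative eigenvalues. Two left-invariant pseudo-Riemannian metrics $g_1, g_2$ on a Lie group $G$ are equivalent up to scaling and automorphisms if there exist $c>0$ and a Lie group automorphism $\varphi: G \to G$ such that for all $a \in G$ and $x, y \in T_aG$, $g_1(x,y)_a = c\, g_2(d\varphi_a(x), d\varphi_a(y))_{\varphi(a)}$. *)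

theory Defs
  imports "HOL-Analysis.Analysis"
begin

fun heis_mult :: "real \<times> real \<times> real \<Rightarrow> real \<times> real \<times> real \<Rightarrow> real \<times> real \<times> real" where
  "heis_mult (x, y, z) (x', y', z') = (x + x', y + y', z + z' + x * y')"

definition G_mult :: "(real \<times> real \<times> real) \<times> (real ^ 'k) \<Rightarrow> (real \<times> real \<times> real) \<times> (real ^ 'k)
                      \<Rightarrow> (real \<times> real \<times> real) \<times> (real ^ 'k)" where
  "G_mult a b = (heis_mult (fst a) (fst b), snd a + snd b)"

fun iter_pderiv :: "'a::euclidean_space list \<Rightarrow> ('a \<Rightarrow> 'b::euclidean_space) \<Rightarrow> 'a \<Rightarrow> 'b" where
  "iter_pderiv [] f = f"
| "iter_pderiv (v # vs) f = (\<lambda>x. frechet_derivative (iter_pderiv vs f) (at x) v)"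

definition smooth_map :: "('a::euclidean_space \<Rightarrow> 'b::euclidean_space) \<Rightarrow> bool" where
  "smooth_map f \<longleftrightarrow> (\<forall>vs. set vs \<subseteq> Basis \<longrightarrow> (\<forall>x. iter_pderiv vs f differentiable (at x)))"

text \<open>The (self-adjoint) operator representing B w.r.t. the standard inner product,
  i.e. the Gram matrix of B in the standard orthonormal basis.\<close>
definition form_op :: "('a::euclidean_space \<Rightarrow> 'a \<Rightarrow> real) \<Rightarrow> 'a \<Rightarrow> 'a" where
  "form_op B y = (\<Sum>b\<in>Basis. B b y *\<^sub>R b)"

text \<open>Number of positive / negative eigenvalues, counted with multiplicity
  (dimension of the span of eigenvectors with positive / negative eigenvalue).\<close>
definition n_pos_eig :: "('a::euclidean_space \<Rightarrow> 'a \<Rightarrow> real) \<Rightarrow> nat" where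
  "n_pos_eig B = dim (span {v. \<exists>l. l > 0 \<and> form_op B v = l *\<^sub>R v})"

definition n_neg_eig :: "('a::euclidean_space \<Rightarrow> 'a \<Rightarrow> real) \<Rightarrow> nat" where
  "n_neg_eig B = dim (span {v. \<exists>l. l < 0 \<and> form_op B v = l *\<^sub>R v})"

definition sym_form :: "('a::euclidean_space \<Rightarrow> 'a \<Rightarrow> real) \<Rightarrow> bool" where
  "sym_form B \<longleftrightarrow> bilinear B \<and> (\<forall>x y. B x y = B y x)"

definition nondegenerate :: "('a::euclidean_space \<Rightarrow> 'a \<Rightarrow> real) \<Rightarrow> bool" where
  "nondegenerate B \<longleftrightarrow> (\<forall>x. (\<forall>y. B x y = 0) \<longrightarrow> x = 0)"

definition has_signature :: "nat \<Rightarrow> nat \<Rightarrow> ('a::euclidean_space \<Rightarrow> 'a \<Rightarrow> real) \<Rightarrow> bool" where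
  "has_signature p q B \<longleftrightarrow> sym_form B \<and> nondegenerate B \<and> n_pos_eig B = p \<and> n_neg_eig B = q"

text \<open>A metric assigns to each point a of G a bilinear form on T_aG, which is
  identified with the underlying Euclidean space.\<close>
type_synonym 'k Gmetric =
  "(real \<times> real \<times> real) \<times> (real ^ 'k) \<Rightarrow> (real \<times> real \<times> real) \<times> (real ^ 'k)
     \<Rightarrow> (real \<times> real \<times> real) \<times> (real ^ 'k) \<Rightarrow> real"

definition left_inv_metric :: "nat \<Rightarrow> nat \<Rightarrow> 'k::finite Gmetric \<Rightarrow> bool" where
  "left_inv_metric p q g \<longleftrightarrow>
     (\<forall>a. has_signature p q (g a)) \<and>
     (\<forall>b a x y. g (G_mult b a) (frechet_derivative (G_mult b) (at a) x)
                              (frechet_derivative (G_mult b) (at a) y) = g a x y)"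

definition G_auto :: "((real \<times> real \<times> real) \<times> (real ^ 'k::finite) \<Rightarrow> (real \<times> real \<times> real) \<times> (real ^ 'k)) \<Rightarrow> bool" where
  "G_auto \<phi> \<longleftrightarrow> bij \<phi> \<and> (\<forall>a b. \<phi> (G_mult a b) = G_mult (\<phi> a) (\<phi> b))
                 \<and> smooth_map \<phi> \<and> smooth_map (inv \<phi>)"

definition metric_equiv :: "'k::finite Gmetric \<Rightarrow> 'k Gmetric \<Rightarrow> bool" where
  "metric_equiv g1 g2 \<longleftrightarrow>
     (\<exists>c>0. \<exists>\<phi>. G_auto \<phi> \<and>
        (\<forall>a x y. g1 a x y = c * g2 (\<phi> a) (frechet_derivative \<phi> (at a) x)
                                         (frechet_derivative \<phi> (at a) y)))"

definition num_classes :: "nat \<Rightarrow> nat \<Rightarrow> 'k::finite itself \<Rightarrow> nat" where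
  "num_classes p q (_ :: 'k itself) =
     card ({g :: 'k Gmetric. left_inv_metric p q g} //
           {(g1, g2). left_inv_metric p q g1 \<and> left_inv_metric p q g2 \<and> metric_equiv g1 g2})"

end

theory Submission
  imports Defs
begin

text \<open>
  At the identity, an automorphism of the group is a linear map that preserves the flag consisting of the
  derived line \<open>\<langle>e\<rangle>\<close> and the centre \<open>Z\<close>, subject to one determinant condition. Rescaling a map that
  preserves the flag achieves this condition, and scaling of the metric is allowed, so the classes are
  the orbits of forms of signature \<open>(p, q)\<close> under the stabiliser of the flag \<open>\<langle>e\<rangle> \<subseteq> Z\<close>.

  Let \<open>P\<close> be the polar plane of \<open>Z\<close>. It has an orthogonal basis with norms \<open>t1 \<ge> t2\<close> in \<open>{-1, 0, 1}\<close>, and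
  \<open>e\<close> is orthogonal to \<open>P\<close>. By Witt's extension theorem the orbit is determined by \<open>t1\<close>, \<open>t2\<close>, the sign of
  the norm of \<open>e\<close>, and whether \<open>e\<close> lies in \<open>P\<close>. An orthogonal family with prescribed norms exists in
  signature \<open>(p, q)\<close> iff it has at most \<open>p\<close> norms \<open>\<ge> 0\<close> and at most \<open>q\<close> norms \<open>\<le> 0\<close>, since each null vector
  uses up a hyperbolic plane. Counting the admissible data gives the numbers.
\<close>

section \<open>Symmetric bilinear forms and their signature\<close>

text \<open>The flag is fixed while the form \<open>B\<close> varies, so the invariants are read
  from the polar plane P. It moves with \<open>B\<close> and recovers Z as its own polar, so an
  isometry that matches polar planes and lines also matches the flags. P may be degenerate, so no
  orthogonal splitting along P is available; completing null vectors to hyperbolic planes removes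
  this obstacle. The definition of signature counts Euclidean eigenvalues of a Gram operator, which
  says nothing directly about other coordinates. The spectral theorem and Sylvester's law replace it
  by counts in arbitrary pseudo-orthonormal bases. An automorphism whose derivative has determinant
  d on the quotient by Z must act by d on the derived line. Rescaling by r changes these two factors
  by r^2 and r, so they can be made equal, and the resulting factor r^2 on the metric is
  positive.\<close>

lemma sym_form_simps:
  assumes "sym_form B"
  shows "B (x + y) z = B x z + B y z" "B z (x + y) = B z x + B z y"
    "B (x - y) z = B x z - B y z" "B z (x - y) = B z x - B z y"
    "B (c *\<^sub>R x) z = c * B x z" "B z (c *\<^sub>R x) = c * B z x"
    "B (- x) z = - B x z" "B z (- x) = - B z x"
    "B 0 z = 0" "B z 0 = 0"
  using assms unfolding sym_form_def
  by (auto simp: bilinear_ladd bilinear_radd bilinear_lsub bilinear_rsub bilinear_lmul bilinear_rmul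
      bilinear_lneg bilinear_rneg bilinear_lzero bilinear_rzero)

lemma sym_form_commute: "sym_form B \<Longrightarrow> B x y = B y x"
  unfolding sym_form_def by blast

lemma sym_form_sum:
  assumes "sym_form B"
  shows "B (\<Sum>i\<in>I. f i) z = (\<Sum>i\<in>I. B (f i) z)" "B z (\<Sum>i\<in>I. f i) = (\<Sum>i\<in>I. B z (f i))"
proof -
  have "linear (\<lambda>x. B x z)" "linear (\<lambda>x. B z x)"
    using assms unfolding sym_form_def bilinear_def by auto
  then show "B (\<Sum>i\<in>I. f i) z = (\<Sum>i\<in>I. B (f i) z)" "B z (\<Sum>i\<in>I. f i) = (\<Sum>i\<in>I. B z (f i))"
    using linear_sum by fastforce+
qed

lemma inner_form_op:
  assumes "sym_form B"
  shows "x \<bullet> form_op B y = B x y"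
proof -
  have "x \<bullet> form_op B y = (\<Sum>b\<in>Basis. (x \<bullet> b) * B b y)"
    unfolding form_op_def by (simp add: inner_sum_right mult.commute)
  also have "\<dots> = B (\<Sum>b\<in>Basis. (x \<bullet> b) *\<^sub>R b) y"
    by (simp add: sym_form_sum[OF assms] sym_form_simps[OF assms])
  finally show ?thesis by (simp add: euclidean_representation)
qed

lemma linear_form_op:
  assumes "sym_form B"
  shows "linear (form_op B)"
  unfolding linear_iff form_op_def
  by (simp add: sym_form_simps[OF assms] scaleR_add_left sum.distrib scaleR_sum_right)

lemma form_op_surj:
  assumes "sym_form B" "nondegenerate B"
  shows "surj (form_op B)"
proof -
  have "inj (form_op B)"
  proof (subst linear_injective_0[OF linear_form_op[OF assms(1)]], intro allI impI)
    fix x assume "form_op B x = 0"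
    then have "\<forall>y. B x y = 0"
      using inner_form_op[OF assms(1)] sym_form_commute[OF assms(1)] by (metis inner_zero_right)
    then show "x = 0" using assms(2) unfolding nondegenerate_def by blast
  qed
  then show ?thesis using linear_injective_imp_surjective linear_form_op[OF assms(1)] by blast
qed

lemma form_op_inj:
  assumes "sym_form B" "nondegenerate B" "\<And>z. B z x = B z y"
  shows "x = y"
proof -
  have "\<forall>z. B (x - y) z = 0"
    using assms(3) sym_form_simps[OF assms(1)] sym_form_commute[OF assms(1)] by (metis right_minus_eq)
  then show ?thesis using assms(2) unfolding nondegenerate_def by (metis right_minus_eq)
qed

section \<open>The spectral theorem for symmetric forms\<close>

lemma quadratic_nonpos_imp_linear_zero:
  fixes a b :: real
  assumes "\<And>t. 2 * t * a + t\<^sup>2 * b \<le> 0"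
  shows "a = 0"
proof (rule ccontr)
  assume "a \<noteq> 0"
  \<comment> \<open>At t = a / M the polynomial equals (a / M)^2 * (2 * M + b), which is positive
    for nonzero a since M exceeds the absolute value of b.\<close>
  define M where "M = \<bar>b\<bar> + 1"
  have "M > 0" "b \<ge> - M" unfolding M_def by auto
  have "2 * (a / M) * a + (a / M)\<^sup>2 * b \<le> 0" using assms .
  then have "M\<^sup>2 * (2 * (a / M) * a + (a / M)\<^sup>2 * b) \<le> 0"
    by (simp add: mult_nonneg_nonpos)
  moreover have "M\<^sup>2 * (2 * (a / M) * a + (a / M)\<^sup>2 * b) = a\<^sup>2 * (2 * M + b)"
    using \<open>M > 0\<close> by (simp add: field_simps power2_eq_square)
  ultimately have "a\<^sup>2 * (2 * M + b) \<le> 0" by simp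
  moreover have "2 * M + b > 0" using \<open>M > 0\<close> \<open>b \<ge> - M\<close> by linarith
  ultimately show False using \<open>a \<noteq> 0\<close> by (simp add: mult_le_0_iff)
qed

text \<open>The Rayleigh quotient attains its maximum on the unit sphere of the complement, and a maximiser
  is an eigenvector there.\<close>
lemma eigenvector_in_complement:
  fixes B :: "'a::euclidean_space \<Rightarrow> 'a \<Rightarrow> real"
  assumes B: "sym_form B" and S: "\<And>s. s \<in> S \<Longrightarrow> \<exists>l. form_op B s = l *\<^sub>R s"
    and z: "z \<noteq> 0" "\<And>s. s \<in> S \<Longrightarrow> z \<bullet> s = 0"
  obtains w l where "norm w = 1" "\<And>s. s \<in> S \<Longrightarrow> w \<bullet> s = 0" "form_op B w = l *\<^sub>R w"
proof -
  define W where "W = {x. \<forall>s\<in>S. x \<bullet> s = 0}"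
  note ba = sym_form_simps[OF B]
  have W_sub: "x + t *\<^sub>R y \<in> W" if "x \<in> W" "y \<in> W" for x y t
    using that unfolding W_def by (simp add: inner_add_left)
  have "W = (\<Inter>s\<in>S. {x. s \<bullet> x = 0})" unfolding W_def by (auto simp: inner_commute)
  then have "closed W" by (simp add: closed_hyperplane closed_INT)
  define K where "K = sphere 0 1 \<inter> W"
  have "compact K" unfolding K_def using \<open>closed W\<close> compact_Int_closed compact_sphere by blast
  have "(1 / norm z) *\<^sub>R z \<in> K" using z unfolding K_def W_def by simp
  then have "K \<noteq> {}" by blast
  have "continuous_on K (\<lambda>x. x \<bullet> form_op B x)"
    by (intro continuous_intros linear_continuous_on linear_form_op B
        linear_conv_bounded_linear[THEN iffD1])
  then obtain w where w: "w \<in> K" "\<And>x. x \<in> K \<Longrightarrow> B x x \<le> B w w"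
    using continuous_attains_sup[OF \<open>compact K\<close> \<open>K \<noteq> {}\<close>, of "\<lambda>x. x \<bullet> form_op B x"]
    unfolding inner_form_op[OF B] by metis
  define l where "l = B w w"
  have w1: "norm w = 1" "w \<in> W" using w unfolding K_def by auto
  have le: "B x x \<le> l * (x \<bullet> x)" if "x \<in> W" for x
  proof (cases "x = 0")
    case False
    have "(1 / norm x) *\<^sub>R x \<in> K" using that False unfolding K_def W_def by simp
    from w(2)[OF this] have "(1 / norm x) * ((1 / norm x) * B x x) \<le> l" 
      by (simp add: ba l_def)
    then have "B x x \<le> l * (norm x)\<^sup>2" using False by (simp add: field_simps power2_eq_square)
    then show ?thesis by (simp add: power2_norm_eq_inner)
  qed (simp add: ba)
  \<comment> \<open>The first-order condition at the maximiser: \<open>le\<close> along the line w +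
    t y is a polynomial in t whose constant term cancels because \<open>w\<close> has norm
    1.\<close>
  have ort: "B w y - l * (w \<bullet> y) = 0" if y: "y \<in> W" for y
  proof (rule quadratic_nonpos_imp_linear_zero)
    fix t
    have "B (w + t *\<^sub>R y) (w + t *\<^sub>R y) \<le> l * ((w + t *\<^sub>R y) \<bullet> (w + t *\<^sub>R y))"
      using le W_sub w1 y by blast
    moreover have "B y w = B w y" by (rule sym_form_commute[OF B])
    moreover have "w \<bullet> w = 1" using w1 by (simp add: norm_eq_1)
    ultimately show "2 * t * (B w y - l * (w \<bullet> y)) + t\<^sup>2 * (B y y - l * (y \<bullet> y)) \<le> 0"
      by (simp add: ba inner_add_left inner_add_right inner_commute[of y w] algebra_simps
          power2_eq_square l_def)
  qed
  \<comment> \<open>The defect of \<open>w\<close> as an eigenvector. Self-adjointness keeps the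
    complement of the eigenvectors in S invariant, so \<open>d\<close> lies in W, and the
    first-order condition tested on \<open>d\<close> itself gives d = 0.\<close>
  define d where "d = form_op B w - l *\<^sub>R w"
  have "d \<bullet> s = 0" if s: "s \<in> S" for s
  proof -
    obtain m where m: "form_op B s = m *\<^sub>R s" using S[OF s] by blast
    have "s \<bullet> form_op B w = w \<bullet> form_op B s"
      using inner_form_op[OF B] sym_form_commute[OF B] by metis
    then have "s \<bullet> form_op B w = 0" "s \<bullet> w = 0" using m w1(2) s unfolding W_def by (auto simp: inner_commute)
    then have "s \<bullet> d = 0" unfolding d_def by (simp add: inner_diff_right)
    then show ?thesis by (simp add: inner_commute)
  qed
  then have "d \<in> W" unfolding W_def by blast
  have "d \<bullet> d = d \<bullet> form_op B w - l * (d \<bullet> w)" by (subst (2) d_def) (simp add: inner_diff_right)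
  also have "\<dots> = 0"
    using ort[OF \<open>d \<in> W\<close>] inner_form_op[OF B] sym_form_commute[OF B] by (metis inner_commute)
  finally have "form_op B w = l *\<^sub>R w" unfolding d_def by simp
  with w1 show thesis unfolding W_def by (intro that[of w l]) auto
qed

text \<open>Independent sets have at most \<open>DIM('a)\<close> members, so one of greatest
  cardinality above \<open>S0\<close> exists. This takes the place of inductions on the dimension:
  \<open>Q\<close> will be orthonormal sets of eigenvectors, and later pseudo-orthonormal
  sets.\<close>

lemma maximal_independent_family:
  fixes S0 :: "'a::euclidean_space set"
  assumes ind: "\<And>S. Q S \<Longrightarrow> independent S" and "Q S0"
  obtains S where "S0 \<subseteq> S" "Q S" "\<And>w. w \<notin> S \<Longrightarrow> \<not> Q (insert w S)"
proof -
  have fin: "finite S \<and> card S \<le> DIM('a)" if "Q S" for S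
    using ind[OF that] independent_bound by blast
  have "\<exists>S. (S0 \<subseteq> S \<and> Q S) \<and> (\<forall>T. S0 \<subseteq> T \<and> Q T \<longrightarrow> card T \<le> card S)"
    using assms(2) fin by (intro ex_has_greatest_nat[of _ S0 _ "Suc DIM('a)"]) (auto simp: less_Suc_eq_le)
  then obtain S where S: "S0 \<subseteq> S" "Q S" "\<And>T. S0 \<subseteq> T \<Longrightarrow> Q T \<Longrightarrow> card T \<le> card S" by blast
  have "\<not> Q (insert w S)" if "w \<notin> S" for w
    using S(3)[of "insert w S"] S(1) that fin[OF S(2)] by auto
  with S that show thesis by blast
qed

text \<open>A maximal orthonormal set of eigenvectors must span: a nonzero vector orthogonal to it
  would yield a further eigenvector in its complement. The eigenvalue of a unit eigenvector s is
  \<open>B s s\<close>.\<close>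

lemma spectral_theorem:
  fixes B :: "'a::euclidean_space \<Rightarrow> 'a \<Rightarrow> real"
  assumes B: "sym_form B"
  obtains S where "pairwise orthogonal S" "\<And>s. s \<in> S \<Longrightarrow> norm s = 1" "span S = UNIV"
    "\<And>s. s \<in> S \<Longrightarrow> form_op B s = B s s *\<^sub>R s"
proof -
  define Q where "Q S \<longleftrightarrow> pairwise orthogonal S \<and> (\<forall>s\<in>S. norm s = 1 \<and> (\<exists>l. form_op B s = l *\<^sub>R s))" for S
  have ind: "independent S" if "Q S" for S
    using that pairwise_orthogonal_independent unfolding Q_def by force
  obtain S where S: "Q S" "\<And>w. w \<notin> S \<Longrightarrow> \<not> Q (insert w S)"
    using maximal_independent_family[of Q "{}"] ind unfolding Q_def by auto
  have "span S = UNIV"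
  proof (rule ccontr)
    assume "span S \<noteq> UNIV"
    then have "span S \<subset> UNIV" by blast
    then obtain z where z: "z \<noteq> 0" "\<And>y. y \<in> span S \<Longrightarrow> orthogonal z y"
      using orthogonal_to_subspace_exists_gen[of S UNIV] by (auto simp: span_UNIV)
    obtain w l where w: "norm w = 1" "\<And>s. s \<in> S \<Longrightarrow> w \<bullet> s = 0" "form_op B w = l *\<^sub>R w"
      using eigenvector_in_complement[OF B, of S z] S(1) z unfolding Q_def orthogonal_def
      by (metis span_base)
    have "w \<notin> S" using w by force
    moreover have "Q (insert w S)"
      using S(1) w unfolding Q_def pairwise_insert orthogonal_def by (auto simp: inner_commute)
    ultimately show False using S(2) by blast
  qed
  moreover have "form_op B s = B s s *\<^sub>R s" if s: "s \<in> S" for s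
  proof -
    obtain l where l: "form_op B s = l *\<^sub>R s" "norm s = 1" using S(1) s unfolding Q_def by blast
    have "B s s = l" using inner_form_op[OF B, of s s] l by (simp add: norm_eq_1)
    with l show ?thesis by simp
  qed
  ultimately show thesis using S(1) that unfolding Q_def by blast
qed

section \<open>Pseudo-orthonormal sets and Sylvester's law of inertia\<close>

definition pseudo_orthonormal :: "('a::euclidean_space \<Rightarrow> 'a \<Rightarrow> real) \<Rightarrow> 'a set \<Rightarrow> bool" where
  "pseudo_orthonormal B S \<longleftrightarrow> (\<forall>x\<in>S. \<forall>y\<in>S. x \<noteq> y \<longrightarrow> B x y = 0) \<and> (\<forall>x\<in>S. B x x = 1 \<or> B x x = -1)"

lemma pseudo_orthonormal_sum:
  assumes "sym_form B" "pseudo_orthonormal B S" "finite S" "y \<in> S"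
  shows "B (\<Sum>x\<in>S. c x *\<^sub>R x) y = c y * B y y"
proof -
  have "B (\<Sum>x\<in>S. c x *\<^sub>R x) y = (\<Sum>x\<in>S. c x * B x y)"
    by (simp add: sym_form_sum[OF assms(1)] sym_form_simps[OF assms(1)])
  also have "\<dots> = (\<Sum>x\<in>S. if x = y then c y * B y y else 0)"
    using assms unfolding pseudo_orthonormal_def by (intro sum.cong) auto
  finally show ?thesis using assms by simp
qed

lemma pseudo_orthonormal_subset: "pseudo_orthonormal B S \<Longrightarrow> T \<subseteq> S \<Longrightarrow> pseudo_orthonormal B T"
  unfolding pseudo_orthonormal_def by blast

lemma pseudo_orthonormal_independent:
  assumes "sym_form B" "pseudo_orthonormal B S"
  shows "independent S"
proof
  assume "dependent S"
  then obtain t u v where t: "finite t" "t \<subseteq> S" "(\<Sum>x\<in>t. u x *\<^sub>R x) = 0" "v \<in> t" "u v \<noteq> 0"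
    unfolding dependent_explicit by blast
  have "u v * B v v = 0"
    using pseudo_orthonormal_sum[OF assms(1) pseudo_orthonormal_subset[OF assms(2) t(2)] t(1,4), of u] t(3)
    by (simp add: sym_form_simps[OF assms(1)])
  moreover have "B v v \<noteq> 0" using assms(2) t unfolding pseudo_orthonormal_def by force
  ultimately show False using t by simp
qed

lemma pseudo_orthonormal_finite: "sym_form B \<Longrightarrow> pseudo_orthonormal B S \<Longrightarrow> finite S"
  using pseudo_orthonormal_independent independent_bound by blast

lemma pseudo_orthonormal_basis_card:
  fixes S :: "'a::euclidean_space set"
  assumes "sym_form B" "pseudo_orthonormal B S" "span S = UNIV"
  shows "card {x\<in>S. B x x = 1} + card {x\<in>S. B x x = -1} = DIM('a)"
proof -
  have "card {x\<in>S. B x x = 1} + card {x\<in>S. B x x = -1} = card ({x\<in>S. B x x = 1} \<union> {x\<in>S. B x x = -1})"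
    using pseudo_orthonormal_finite[OF assms(1,2)] by (intro card_Un_disjoint[symmetric]) auto
  also have "{x\<in>S. B x x = 1} \<union> {x\<in>S. B x x = -1} = S" using assms(2) unfolding pseudo_orthonormal_def by auto
  also have "card S = DIM('a)"
    using pseudo_orthonormal_independent[OF assms(1,2)] assms(3) dim_eq_card_independent[of S] dim_span[of S] by simp
  finally show ?thesis .
qed

text \<open>\<open>B y y\<close> is s times a sum of squares, and s * s = 1. The sign is a variable
  so that positive and negative definite spans are one case.\<close>

lemma pseudo_orthonormal_definite_span:
  assumes B: "sym_form B" "pseudo_orthonormal B S" and s: "\<And>x. x \<in> S \<Longrightarrow> B x x = s" and y: "y \<in> span S" "y \<noteq> 0"
  shows "s * B y y > 0"
proof -
  have fin: "finite S" using pseudo_orthonormal_finite B by blast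
  obtain c where c: "y = (\<Sum>x\<in>S. c x *\<^sub>R x)" using y(1) unfolding span_finite[OF fin] by blast
  have "\<exists>x\<in>S. c x \<noteq> 0" using c y(2) by (metis (no_types, lifting) scaleR_eq_0_iff sum.neutral)
  then obtain x0 where x0: "x0 \<in> S" "c x0 \<noteq> 0" by blast
  have "B y y = (\<Sum>x\<in>S. c x * B y x)"
    by (subst (2) c) (simp add: sym_form_sum[OF B(1)] sym_form_simps[OF B(1)])
  also have "\<dots> = (\<Sum>x\<in>S. (c x)\<^sup>2 * s)"
    by (intro sum.cong) (auto simp: c pseudo_orthonormal_sum[OF B fin] s power2_eq_square)
  finally have "B y y = s * (\<Sum>x\<in>S. (c x)\<^sup>2)" by (simp add: sum_distrib_left mult.commute)
  moreover have "(\<Sum>x\<in>S. (c x)\<^sup>2) > 0"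
    using x0 fin by (intro sum_pos2[of S x0]) auto
  moreover have "s * s = 1" using s[OF x0(1)] B(2) x0(1) unfolding pseudo_orthonormal_def by auto
  ultimately show ?thesis by (simp add: mult.assoc[symmetric])
qed

text \<open>A positive definite span and a negative definite one meet only in 0, so their dimensions
  add up to at most that of the space. The sets \<open>S\<close> and \<open>T\<close> are unrelated;
  exchanging their roles gives the law of inertia.\<close>

lemma sylvester_le:
  fixes S T :: "'a::euclidean_space set"
  assumes B: "sym_form B" and S: "pseudo_orthonormal B S" and T: "pseudo_orthonormal B T"
  shows "card {x\<in>S. B x x = 1} + card {x\<in>T. B x x = -1} \<le> DIM('a)"
proof -
  define S1 T1 where "S1 = {x\<in>S. B x x = 1}" and "T1 = {x\<in>T. B x x = -1}"
  have pon: "pseudo_orthonormal B S1" "pseudo_orthonormal B T1" using S T unfolding S1_def T1_def pseudo_orthonormal_def by auto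
  have "span S1 \<inter> span T1 = {0}"
  proof -
    have "y = 0" if y: "y \<in> span S1" "y \<in> span T1" for y
    proof (rule ccontr)
      assume "y \<noteq> 0"
      then have "1 * B y y > 0" "(-1) * B y y > 0"
        using pseudo_orthonormal_definite_span[OF B pon(1), of 1 y] pseudo_orthonormal_definite_span[OF B pon(2), of "-1" y] y
        unfolding S1_def T1_def by auto
      then show False by simp
    qed
    then show ?thesis using span_zero by blast
  qed
  then have "dim {x + y |x y. x \<in> span S1 \<and> y \<in> span T1} = dim (span S1) + dim (span T1)"
    using dim_sums_Int[of "span S1" "span T1"] by simp
  also have "\<dots> = card S1 + card T1"
    using pseudo_orthonormal_independent[OF B pon(1)] pseudo_orthonormal_independent[OF B pon(2)]
    by (simp add: dim_eq_card_independent)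
  finally show ?thesis
    using dim_subset_UNIV[of "{x + y |x y. x \<in> span S1 \<and> y \<in> span T1}"] unfolding S1_def T1_def by simp
qed

lemma sylvester_eq:
  fixes S T :: "'a::euclidean_space set"
  assumes B: "sym_form B" and S: "pseudo_orthonormal B S" "span S = UNIV" and T: "pseudo_orthonormal B T" "span T = UNIV"
  shows "card {x\<in>S. B x x = 1} = card {x\<in>T. B x x = 1}" "card {x\<in>S. B x x = -1} = card {x\<in>T. B x x = -1}"
  using pseudo_orthonormal_basis_card[OF B S] pseudo_orthonormal_basis_card[OF B T] sylvester_le[OF B S(1) T(1)] sylvester_le[OF B T(1) S(1)]
  by linarith+

lemma dim_span_eigenvectors:
  fixes T :: "'a::euclidean_space \<Rightarrow> 'a"
  assumes T: "linear T" and S: "pairwise orthogonal S" "\<And>s. s \<in> S \<Longrightarrow> norm s = 1" "span S = UNIV"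
    "\<And>s. s \<in> S \<Longrightarrow> T s = m s *\<^sub>R s"
  shows "dim (span {v. \<exists>l. P l \<and> T v = l *\<^sub>R v}) = card {s\<in>S. P (m s)}"
proof -
  have "0 \<notin> S" using S(2) by force
  then have ind: "independent S" using S(1) pairwise_orthogonal_independent by blast
  then have fin: "finite S" using independent_bound by blast
  let ?E = "{v. \<exists>l. P l \<and> T v = l *\<^sub>R v}" and ?S = "{s\<in>S. P (m s)}"
  have sub: "?S \<subseteq> ?E" using S(4) by blast
  have "v \<in> span ?S" if v: "v \<in> ?E" for v
  proof -
    obtain l where l: "P l" "T v = l *\<^sub>R v" using v by blast
    obtain c where c: "v = (\<Sum>s\<in>S. c s *\<^sub>R s)" using S(3) span_finite[OF fin] by blast
    have "(\<Sum>s\<in>S. (c s * m s - l * c s) *\<^sub>R s) = T v - l *\<^sub>R v"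
      unfolding c linear_sum[OF T] scaleR_sum_right sum_subtractf[symmetric]
      by (intro sum.cong) (auto simp: linear_scale[OF T] S(4) scaleR_diff_left)
    then have "(\<Sum>s\<in>S. (c s * m s - l * c s) *\<^sub>R s) = 0" using l by simp
    then have "c s * m s - l * c s = 0" if "s \<in> S" for s
      using ind fin that independentD[of S S "\<lambda>s. c s * m s - l * c s" s] by auto
    then have z: "c s = 0" if "s \<in> S" "\<not> P (m s)" for s using that l(1) by (metis eq_iff_diff_eq_0 mult.commute mult_cancel_left)
    have "v = (\<Sum>s\<in>?S. c s *\<^sub>R s)"
      unfolding c using z by (intro sum.mono_neutral_right fin) auto
    also have "\<dots> \<in> span ?S" by (intro span_sum span_scale span_base) auto
    finally show ?thesis .
  qed
  then have "span ?E = span ?S" using sub by (meson span_mono span_minimal subsetI subset_antisym subspace_span)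
  moreover have "independent ?S" by (rule independent_mono[OF ind]) blast
  ultimately show ?thesis by (simp add: dim_eq_card_independent)
qed

text \<open>The eigenvalue \<open>B s s\<close> of a unit eigenvector is nonzero by nondegeneracy,
  and dividing s by the square root of its absolute value turns it into its sign. The signs of the
  norms thus count the signs of the eigenvalues.\<close>

lemma pseudo_orthonormal_eigenbasis_exists:
  fixes B :: "'a::euclidean_space \<Rightarrow> 'a \<Rightarrow> real"
  assumes B: "sym_form B" "nondegenerate B"
  obtains S where "pseudo_orthonormal B S" "span S = UNIV" "card {x\<in>S. B x x = 1} = n_pos_eig B"
    "card {x\<in>S. B x x = -1} = n_neg_eig B"
proof -
  obtain S where S: "pairwise orthogonal S" "\<And>s. s \<in> S \<Longrightarrow> norm s = 1" "span S = UNIV"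
    "\<And>s. s \<in> S \<Longrightarrow> form_op B s = B s s *\<^sub>R s" using spectral_theorem[OF B(1)] by blast
  note ba = sym_form_simps[OF B(1)]
  have nz: "B s s \<noteq> 0" if "s \<in> S" for s
  proof
    assume "B s s = 0"
    then have "form_op B s = 0" using S(4) that by simp
    then have "s = 0" using form_op_inj[OF B, of s 0] inner_form_op[OF B(1)] ba by (metis inner_zero_right)
    then show False using S(2) that by force
  qed
  have orth: "B x y = 0" if "x \<in> S" "y \<in> S" "x \<noteq> y" for x y
    using inner_form_op[OF B(1), of x y] S that by (auto simp: pairwise_def orthogonal_def)
  define N where "N s = (1 / sqrt \<bar>B s s\<bar>) *\<^sub>R s" for s
  have NN: "B (N s) (N s) = sgn (B s s)" if "s \<in> S" for s
  proof -
    have "B (N s) (N s) = B s s / (sqrt \<bar>B s s\<bar> * sqrt \<bar>B s s\<bar>)" unfolding N_def by (simp add: ba)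
    also have "\<dots> = B s s / \<bar>B s s\<bar>" by simp
    finally show ?thesis by (simp add: sgn_if)
  qed
  \<comment> \<open>Counting in an image requires that no two vectors collapse. Two that did would
    give a vector orthogonal to itself, although its norm is 1 or -1.\<close>
  have inj: "inj_on N S"
  proof (rule inj_onI, rule ccontr)
    fix x y assume xy: "x \<in> S" "y \<in> S" "N x = N y" "x \<noteq> y"
    have "B (N x) (N x) = B (N x) (N y)" using xy by simp
    also have "\<dots> = 0" using orth[OF xy(1,2,4)] unfolding N_def by (simp add: ba)
    finally show False using NN xy(1) nz by (simp add: sgn_0_0)
  qed
  have "pseudo_orthonormal B (N ` S)"
    unfolding pseudo_orthonormal_def using NN nz orth by (auto simp: N_def ba sgn_if)
  moreover have "span (N ` S) = UNIV"
  proof -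
    have "s \<in> span (N ` S)" if "s \<in> S" for s
    proof -
      have "s = sqrt \<bar>B s s\<bar> *\<^sub>R N s" using nz[OF that] unfolding N_def by simp
      then show ?thesis using that by (metis imageI span_base span_scale)
    qed
    then show ?thesis using S(3) by (metis span_minimal subsetI subspace_span top.extremum_uniqueI)
  qed
  moreover have "card {x\<in>N ` S. B x x = 1} = n_pos_eig B"
  proof -
    have "{x\<in>N ` S. B x x = 1} = N ` {s\<in>S. B s s > 0}" using NN nz by (auto simp: sgn_if split: if_splits)
    then have "card {x\<in>N ` S. B x x = 1} = card {s\<in>S. B s s > 0}"
      using inj by (metis (no_types, lifting) card_image inj_on_subset mem_Collect_eq subsetI)
    then show ?thesis unfolding n_pos_eig_def using dim_span_eigenvectors[OF linear_form_op[OF B(1)] S, of "\<lambda>l. l > 0"] by simp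
  qed
  moreover have "card {x\<in>N ` S. B x x = -1} = n_neg_eig B"
  proof -
    have "{x\<in>N ` S. B x x = -1} = N ` {s\<in>S. B s s < 0}" using NN nz
      by (auto simp: sgn_if split: if_splits) (metis (mono_tags, lifting) imageI linorder_neqE_linordered_idom mem_Collect_eq)
    then have "card {x\<in>N ` S. B x x = -1} = card {s\<in>S. B s s < 0}"
      using inj by (metis (no_types, lifting) card_image inj_on_subset mem_Collect_eq subsetI)
    then show ?thesis unfolding n_neg_eig_def using dim_span_eigenvectors[OF linear_form_op[OF B(1)] S, of "\<lambda>l. l < 0"] by simp
  qed
  ultimately show thesis using that by blast
qed

lemma pseudo_orthonormal_basis_card_eig:
  assumes B: "sym_form B" "nondegenerate B" and S: "pseudo_orthonormal B S" "span S = UNIV"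
  shows "card {x\<in>S. B x x = 1} = n_pos_eig B" "card {x\<in>S. B x x = -1} = n_neg_eig B"
proof -
  obtain T where T: "pseudo_orthonormal B T" "span T = UNIV" "card {x\<in>T. B x x = 1} = n_pos_eig B"
    "card {x\<in>T. B x x = -1} = n_neg_eig B" using pseudo_orthonormal_eigenbasis_exists[OF B] by blast
  show "card {x\<in>S. B x x = 1} = n_pos_eig B" "card {x\<in>S. B x x = -1} = n_neg_eig B"
    using sylvester_eq[OF B(1) S T(1,2)] T(3,4) by simp_all
qed

lemma pseudo_orthonormal_basis_nondegenerate:
  assumes B: "sym_form B" and S: "pseudo_orthonormal B S" "span S = UNIV"
  shows "nondegenerate B"
  unfolding nondegenerate_def
proof (intro allI impI)
  fix x assume x: "\<forall>y. B x y = 0"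
  have fin: "finite S" using pseudo_orthonormal_finite B S by blast
  obtain c where c: "x = (\<Sum>s\<in>S. c s *\<^sub>R s)" using S(2) span_finite[OF fin] by blast
  have "c s = 0" if "s \<in> S" for s
    using pseudo_orthonormal_sum[OF B S(1) fin that, of c] x that S(1) unfolding c pseudo_orthonormal_def by force
  then show "x = 0" unfolding c by simp
qed

text \<open>The right-hand side does not refer to the Euclidean inner product, so it can be
  transported along any linear bijection. The existential choice of basis is harmless by Sylvester's
  law.\<close>

lemma has_signature_iff_pseudo_orthonormal_basis:
  "has_signature p q B \<longleftrightarrow> sym_form B \<and>
     (\<exists>S. pseudo_orthonormal B S \<and> span S = UNIV \<and> card {x\<in>S. B x x = 1} = p \<and> card {x\<in>S. B x x = -1} = q)"
  (is "?L \<longleftrightarrow> ?R")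
proof
  assume ?L
  then have B: "sym_form B" "nondegenerate B" "n_pos_eig B = p" "n_neg_eig B = q"
    unfolding has_signature_def by auto
  obtain T where "pseudo_orthonormal B T" "span T = UNIV" "card {x\<in>T. B x x = 1} = n_pos_eig B"
    "card {x\<in>T. B x x = -1} = n_neg_eig B" using pseudo_orthonormal_eigenbasis_exists[OF B(1,2)] by blast
  with B show ?R by auto
next
  assume ?R
  then obtain S where B: "sym_form B" and S: "pseudo_orthonormal B S" "span S = UNIV"
    "card {x\<in>S. B x x = 1} = p" "card {x\<in>S. B x x = -1} = q" by blast
  have n: "nondegenerate B" using pseudo_orthonormal_basis_nondegenerate[OF B S(1,2)] .
  show ?L using pseudo_orthonormal_basis_card_eig[OF B n S(1,2)] B n S(3,4) unfolding has_signature_def by simp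
qed

section \<open>Orthogonal families and Witt's extension theorem\<close>

text \<open>Indexed, unlike \<open>independent\<close>, so that a repeated vector counts as a
  dependence and norms can be prescribed index by index.\<close>

definition lin_indep_family :: "'i set \<Rightarrow> ('i \<Rightarrow> 'a::real_vector) \<Rightarrow> bool" where
  "lin_indep_family I x \<longleftrightarrow> (\<forall>c. (\<Sum>i\<in>I. c i *\<^sub>R x i) = 0 \<longrightarrow> (\<forall>i\<in>I. c i = 0))"

text \<open>Independence is a separate demand because the orthogonality relations do not imply it
  for null vectors: two of them may be proportional and still orthogonal.\<close>

definition orth_family :: "('a::euclidean_space \<Rightarrow> 'a \<Rightarrow> real) \<Rightarrow> 'i set \<Rightarrow> ('i \<Rightarrow> 'a) \<Rightarrow> ('i \<Rightarrow> real) \<Rightarrow> bool" where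
  "orth_family B I x \<epsilon> \<longleftrightarrow> lin_indep_family I x \<and> (\<forall>i\<in>I. \<epsilon> i \<in> {-1, 0, 1}) \<and>
     (\<forall>i\<in>I. \<forall>j\<in>I. B (x i) (x j) = (if i = j then \<epsilon> i else 0))"

lemma lin_indep_family_inj_on:
  assumes "finite I" "lin_indep_family I x"
  shows "inj_on x I"
proof (rule inj_onI, rule ccontr)
  fix i j assume ij: "i \<in> I" "j \<in> I" "x i = x j" "i \<noteq> j"
  define c where "c k = (if k = i then 1 else if k = j then -1 else 0 :: real)" for k
  have "(\<Sum>k\<in>I. c k *\<^sub>R x k) = (\<Sum>k\<in>I. (if k = i then x i else 0) + (if k = j then - x j else 0))"
    using ij by (intro sum.cong) (auto simp: c_def)
  also have "\<dots> = 0" using ij assms(1) by (simp add: sum.distrib)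
  finally have "c i = 0" using assms(2) ij unfolding lin_indep_family_def by blast
  then show False by (simp add: c_def)
qed

lemma lin_indep_family_independent:
  assumes "finite I" "lin_indep_family I x"
  shows "independent (x ` I)"
proof
  have inj: "inj_on x I" using assms by (rule lin_indep_family_inj_on)
  assume "dependent (x ` I)"
  then obtain u i where u: "i \<in> I" "u (x i) \<noteq> 0" "(\<Sum>v\<in>x ` I. u v *\<^sub>R v) = 0"
    using assms(1) by (auto simp: dependent_finite)
  then have "(\<Sum>k\<in>I. u (x k) *\<^sub>R x k) = 0" by (simp add: sum.reindex[OF inj])
  then have "u (x i) = 0" using assms(2)[unfolded lin_indep_family_def, rule_format, of "\<lambda>k. u (x k)"] u(1) by blast
  with u show False by simp
qed

lemma linear_functional_represented:
  fixes g :: "'a::euclidean_space \<Rightarrow> real"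
  assumes B: "sym_form B" "nondegenerate B" and g: "linear g"
  obtains w where "\<And>y. B w y = g y"
proof -
  obtain w where w: "form_op B w = (\<Sum>b\<in>Basis. g b *\<^sub>R b)" using form_op_surj[OF B] by (metis surjD)
  have "B w y = g y" for y
  proof -
    have "B w y = y \<bullet> form_op B w" using inner_form_op[OF B(1)] sym_form_commute[OF B(1)] by metis
    also have "\<dots> = (\<Sum>b\<in>Basis. (y \<bullet> b) * g b)" unfolding w by (simp add: inner_sum_right mult.commute)
    also have "\<dots> = g (\<Sum>b\<in>Basis. (y \<bullet> b) *\<^sub>R b)" by (simp add: linear_sum[OF g] linear_scale[OF g])
    finally show ?thesis by (simp add: euclidean_representation)
  qed
  then show thesis using that by blast
qed

text \<open>Nondegeneracy represents the coordinate functionals of the family by vectors. Even a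
  null \<open>x i\<close> thereby gets a partner on which it does not vanish.\<close>

lemma dual_family_exists:
  fixes x :: "'i \<Rightarrow> 'a::euclidean_space"
  assumes B: "sym_form B" "nondegenerate B" and I: "finite I" "lin_indep_family I x"
  obtains w where "\<And>i j. i \<in> I \<Longrightarrow> j \<in> I \<Longrightarrow> B (w i) (x j) = (if i = j then 1 else 0)"
proof -
  have "\<exists>w. \<forall>j\<in>I. B w (x j) = (if i = j then 1 else 0)" if i: "i \<in> I" for i
  proof -
    obtain g :: "'a \<Rightarrow> real" where g: "linear g" "\<And>y. y \<in> x ` I \<Longrightarrow> g y = (if y = x i then 1 else 0)"
      using linear_independent_extend[OF lin_indep_family_independent[OF I], of "\<lambda>y. if y = x i then 1 else 0"] by blast
    obtain w where w: "\<And>y. B w y = g y" using linear_functional_represented[OF B g(1)] by blast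
    have "\<forall>j\<in>I. B w (x j) = (if i = j then 1 else 0)"
      using w g(2) lin_indep_family_inj_on[OF I] i by (auto dest: inj_onD)
    then show ?thesis by blast
  qed
  then obtain w where "\<And>i. i \<in> I \<Longrightarrow> \<forall>j\<in>I. B (w i) (x j) = (if i = j then 1 else 0)" by metis
  then show thesis using that by blast
qed

text \<open>Each null vector \<open>x i\<close> is paired with a null vector \<open>w' i\<close> to a hyperbolic plane, in which
  \<open>x i\<close> is the sum of a unit spacelike and a unit timelike vector.\<close>
lemma orth_family_hyperbolic_completion:
  fixes x :: "'i \<Rightarrow> 'a::euclidean_space"
  assumes B: "sym_form B" "nondegenerate B" and I: "finite I" "orth_family B I x \<epsilon>"
  obtains f g where "\<forall>i\<in>I. x i = f i + g i"
    "\<forall>i\<in>I. \<epsilon> i < 0 \<longrightarrow> f i = 0" "\<forall>i\<in>I. \<epsilon> i > 0 \<longrightarrow> g i = 0"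
    "\<forall>i\<in>I. \<forall>j\<in>I. B (f i) (f j) = (if i = j \<and> \<epsilon> i \<ge> 0 then 1 else 0)"
    "\<forall>i\<in>I. \<forall>j\<in>I. B (g i) (g j) = (if i = j \<and> \<epsilon> i \<le> 0 then -1 else 0)"
    "\<forall>i\<in>I. \<forall>j\<in>I. B (f i) (g j) = 0"
proof -
  note ba = sym_form_simps[OF B(1)] and bs = sym_form_sum[OF B(1)] and bc = sym_form_commute[OF B(1)]
  have ind: "lin_indep_family I x" and eps: "\<And>i. i \<in> I \<Longrightarrow> \<epsilon> i \<in> {-1,0,1}"
    and xx: "\<And>i j. i \<in> I \<Longrightarrow> j \<in> I \<Longrightarrow> B (x i) (x j) = (if i = j then \<epsilon> i else 0)"
    using I unfolding orth_family_def by auto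
  obtain w where w: "\<And>i j. i \<in> I \<Longrightarrow> j \<in> I \<Longrightarrow> B (w i) (x j) = (if i = j then 1 else 0)"
    using dual_family_exists[OF B I(1) ind] by blast
  define N where "N = {i\<in>I. \<epsilon> i = 0}"
  have N: "finite N" "N \<subseteq> I" using I unfolding N_def by auto
  \<comment> \<open>Half of the Gram matrix of the \<open>w i\<close>, written in the null vectors.
    Subtracting \<open>h i\<close> keeps all pairings with the \<open>x j\<close>, and each of the
    two cross terms in the product of \<open>w' i\<close> and \<open>w' j\<close> removes half of
    \<open>B (w i) (w j)\<close>, so the partners become null and mutually orthogonal.\<close>
  define h where "h i = (1/2) *\<^sub>R (\<Sum>k\<in>N. B (w i) (w k) *\<^sub>R x k)" for i
  define w' where "w' i = w i - h i" for i
  have hx: "B (h i) (x j) = 0" if "j \<in> I" for i j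
  proof -
    have "B (h i) (x j) = (1/2) * (\<Sum>k\<in>N. B (w i) (w k) * B (x k) (x j))" unfolding h_def by (simp add: ba bs)
    also have "\<dots> = (1/2) * (\<Sum>k\<in>N. 0)"
      using xx N that unfolding N_def by (intro arg_cong[of _ _ "\<lambda>t. (1/2) * t"] sum.cong) auto
    finally show ?thesis by simp
  qed
  have wx: "B (w' i) (x j) = (if i = j then 1 else 0)" "B (x j) (w' i) = (if i = j then 1 else 0)"
    if "i \<in> I" "j \<in> I" for i j
    using w[OF that] hx that bc[of "x j"] unfolding w'_def by (auto simp: ba)
  have wh: "B (w i) (h j) = B (w i) (w j) / 2" if ij: "i \<in> N" "j \<in> N" for i j
  proof -
    have "B (w i) (h j) = (1/2) * (\<Sum>k\<in>N. B (w j) (w k) * B (w i) (x k))" unfolding h_def by (simp add: ba bs)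
    also have "(\<Sum>k\<in>N. B (w j) (w k) * B (w i) (x k)) = (\<Sum>k\<in>N. if k = i then B (w j) (w i) else 0)"
    proof (intro sum.cong refl)
      fix k assume "k \<in> N"
      then have "B (w i) (x k) = (if i = k then 1 else 0)" using w ij N by blast
      then show "B (w j) (w k) * B (w i) (x k) = (if k = i then B (w j) (w i) else 0)" by simp
    qed
    finally show ?thesis using ij N bc[of "w j" "w i"] by simp
  qed
  have hh: "B (h i) (h j) = 0" for i j
  proof -
    have "B (h i) (h j) = (1/2) * (\<Sum>k\<in>N. B (w j) (w k) * B (h i) (x k))" by (subst (2) h_def) (simp add: ba bs)
    then show ?thesis using hx N by (simp add: subset_iff)
  qed
  have ww: "B (w' i) (w' j) = 0" if "i \<in> N" "j \<in> N" for i j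
    using wh[OF that] wh[OF that(2,1)] bc[of "h i" "w j"] bc[of "w j" "w i"] hh unfolding w'_def by (simp add: ba)
  \<comment> \<open>For null x and w' with \<open>B x w' = 1\<close>, the vectors x/2 + w' and x/2 -
    w' are orthogonal, have norms 1 and -1, and add up to x. A vector of norm 1 or -1 is its own
    part of that sign, and 0 is the default for the other part.\<close>
  define f where "f i = (if \<epsilon> i = 0 then (1/2) *\<^sub>R x i + w' i else if \<epsilon> i = 1 then x i else 0)" for i
  define g where "g i = (if \<epsilon> i = 0 then (1/2) *\<^sub>R x i - w' i else if \<epsilon> i = 1 then 0 else x i)" for i
  have fg1: "x i = f i + g i" for i
  proof -
    have "(1/2) *\<^sub>R x i + w' i + ((1/2) *\<^sub>R x i - w' i) = (1/2 + 1/2) *\<^sub>R x i"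
      unfolding scaleR_add_left by simp
    then show ?thesis unfolding f_def g_def by auto
  qed
  have fg2: "\<epsilon> i < 0 \<longrightarrow> f i = 0" "\<epsilon> i > 0 \<longrightarrow> g i = 0" if "i \<in> I" for i
    using eps[OF that] unfolding f_def g_def by auto
  have fg3: "B (f i) (f j) = (if i = j \<and> \<epsilon> i \<ge> 0 then 1 else 0)"
    "B (g i) (g j) = (if i = j \<and> \<epsilon> i \<le> 0 then -1 else 0)" "B (f i) (g j) = 0" if i: "i \<in> I" and j: "j \<in> I" for i j
  proof -
    have W: "\<epsilon> i = 0 \<Longrightarrow> \<epsilon> j = 0 \<Longrightarrow> B (w' i) (w' j) = 0" using ww i j unfolding N_def by blast
    show "B (f i) (f j) = (if i = j \<and> \<epsilon> i \<ge> 0 then 1 else 0)"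
      using eps[OF i] eps[OF j] W xx[OF i j] wx[OF i j] wx[OF j i] unfolding f_def by (auto simp: ba)
    show "B (g i) (g j) = (if i = j \<and> \<epsilon> i \<le> 0 then -1 else 0)"
      using eps[OF i] eps[OF j] W xx[OF i j] wx[OF i j] wx[OF j i] unfolding g_def by (auto simp: ba)
    show "B (f i) (g j) = 0"
      using eps[OF i] eps[OF j] W xx[OF i j] wx[OF i j] wx[OF j i] unfolding f_def g_def by (auto simp: ba)
  qed
  show thesis using that[of f g] fg1 fg2 fg3 by blast
qed

text \<open>The orthogonal complement W of a maximal set contains only null vectors, since any other
  could be normalised and added. By polarisation \<open>B\<close> vanishes on W, and projecting
  along the set shows that W is orthogonal to the whole space, hence zero.\<close>

lemma pseudo_orthonormal_extend_to_basis:
  fixes S0 :: "'a::euclidean_space set"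
  assumes B: "sym_form B" "nondegenerate B" and "pseudo_orthonormal B S0"
  obtains S where "S0 \<subseteq> S" "pseudo_orthonormal B S" "span S = UNIV"
proof -
  note ba = sym_form_simps[OF B(1)] and bs = sym_form_sum[OF B(1)] and bc = sym_form_commute[OF B(1)]
  obtain S where S: "S0 \<subseteq> S" "pseudo_orthonormal B S" "\<And>w. w \<notin> S \<Longrightarrow> \<not> pseudo_orthonormal B (insert w S)"
    using maximal_independent_family[of "pseudo_orthonormal B" S0] pseudo_orthonormal_independent[OF B(1)] assms(3) by blast
  have fin: "finite S" using pseudo_orthonormal_finite[OF B(1) S(2)] .
  define W where "W = {x. \<forall>s\<in>S. B x s = 0}"
  have null: "B w w = 0" if w: "w \<in> W" for w
  proof (rule ccontr)
    assume nz: "B w w \<noteq> 0"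
    define v where "v = (1 / sqrt \<bar>B w w\<bar>) *\<^sub>R w"
    have "B v v = B w w / (sqrt \<bar>B w w\<bar> * sqrt \<bar>B w w\<bar>)" unfolding v_def by (simp add: ba)
    also have "\<dots> = B w w / \<bar>B w w\<bar>" by simp
    finally have vv: "B v v = 1 \<or> B v v = -1" using nz by (auto simp: abs_if)
    have vs: "B v s = 0" if "s \<in> S" for s using w that unfolding v_def W_def by (simp add: ba)
    have "v \<notin> S" using vv vs by force
    moreover have "B s v = 0" if "s \<in> S" for s using vs[OF that] bc[of s v] by simp
    then have "pseudo_orthonormal B (insert v S)" using S(2) vv vs unfolding pseudo_orthonormal_def by simp
    ultimately show False using S(3) by blast
  qed
  \<comment> \<open>\<open>B s s\<close> is its own inverse, so this subtracts the orthogonal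
    projection onto the span of S.\<close>
  have proj: "x - (\<Sum>s\<in>S. (B x s * B s s) *\<^sub>R s) \<in> W" for x
  proof -
    have "B s s * B s s = 1" if "s \<in> S" for s using S(2) that unfolding pseudo_orthonormal_def by auto
    then show ?thesis unfolding W_def by (auto simp: ba pseudo_orthonormal_sum[OF B(1) S(2) fin])
  qed
  have "w = 0" if w: "w \<in> W" for w
  proof -
    have "B w y = 0" for y
    proof -
      define z where "z = y - (\<Sum>s\<in>S. (B y s * B s s) *\<^sub>R s)"
      have z: "z \<in> W" unfolding z_def by (rule proj)
      have "w + z \<in> W" using w z unfolding W_def by (simp add: ba)
      \<comment> \<open>Polarisation: the norm of w + z is twice \<open>B w z\<close> because w and
        z are null.\<close>
      from null[OF this] have "B w z = 0" using null[OF w] null[OF z] bc[of z w] by (simp add: ba)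
      moreover have "B w (\<Sum>s\<in>S. (B y s * B s s) *\<^sub>R s) = 0" using w unfolding W_def by (simp add: ba bs)
      ultimately show ?thesis unfolding z_def by (simp add: ba)
    qed
    then show ?thesis using B(2) unfolding nondegenerate_def by blast
  qed
  then have "x = (\<Sum>s\<in>S. (B x s * B s s) *\<^sub>R s)" for x using proj[of x] by (metis eq_iff_diff_eq_0)
  moreover have "(\<Sum>s\<in>S. (B x s * B s s) *\<^sub>R s) \<in> span S" for x by (intro span_sum span_scale span_base)
  ultimately have "span S = UNIV" by (metis UNIV_eq_I)
  with S that show thesis by blast
qed

text \<open>Each \<open>x i\<close> becomes one basis vector or the sum of two, in a pattern fixed
  by \<epsilon> alone. Families with the same norms therefore look alike in their respective bases,
  even when they span degenerate subspaces.\<close>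

lemma orth_family_extend_to_basis:
  fixes x :: "'i \<Rightarrow> 'a::euclidean_space"
  assumes B: "sym_form B" "nondegenerate B" and I: "finite I" "orth_family B I x \<epsilon>"
  obtains f g S where "\<forall>i\<in>I. x i = f i + g i"
    "\<forall>i\<in>I. \<epsilon> i < 0 \<longrightarrow> f i = 0" "\<forall>i\<in>I. \<epsilon> i > 0 \<longrightarrow> g i = 0"
    "pseudo_orthonormal B S" "span S = UNIV" "inj_on f {i\<in>I. \<epsilon> i \<ge> 0}" "inj_on g {i\<in>I. \<epsilon> i \<le> 0}"
    "f ` {i\<in>I. \<epsilon> i \<ge> 0} \<subseteq> {s\<in>S. B s s = 1}" "g ` {i\<in>I. \<epsilon> i \<le> 0} \<subseteq> {s\<in>S. B s s = -1}"
proof -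
  obtain f g where fg: "\<forall>i\<in>I. x i = f i + g i"
    "\<forall>i\<in>I. \<epsilon> i < 0 \<longrightarrow> f i = 0" "\<forall>i\<in>I. \<epsilon> i > 0 \<longrightarrow> g i = 0"
    "\<forall>i\<in>I. \<forall>j\<in>I. B (f i) (f j) = (if i = j \<and> \<epsilon> i \<ge> 0 then 1 else 0)"
    "\<forall>i\<in>I. \<forall>j\<in>I. B (g i) (g j) = (if i = j \<and> \<epsilon> i \<le> 0 then -1 else 0)"
    "\<forall>i\<in>I. \<forall>j\<in>I. B (f i) (g j) = 0"
    using orth_family_hyperbolic_completion[OF B I] by blast
  let ?F = "{i\<in>I. \<epsilon> i \<ge> 0}" and ?G = "{i\<in>I. \<epsilon> i \<le> 0}"
  have gf: "B (g j) (f i) = 0" if "i \<in> I" "j \<in> I" for i j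
    using fg(6) that sym_form_commute[OF B(1)] by metis
  have "pseudo_orthonormal B (f ` ?F \<union> g ` ?G)"
    unfolding pseudo_orthonormal_def using fg(4,5,6) gf by (auto split: if_splits)
  then obtain S where S: "f ` ?F \<union> g ` ?G \<subseteq> S" "pseudo_orthonormal B S" "span S = UNIV" using pseudo_orthonormal_extend_to_basis[OF B] by blast
  have "inj_on f ?F"
  proof (rule inj_onI)
    fix i j assume ij: "i \<in> ?F" "j \<in> ?F" "f i = f j"
    then have "B (f i) (f j) = 1" using fg(4)[rule_format, of i i] by auto
    then show "i = j" using fg(4)[rule_format, of i j] ij by (auto split: if_splits)
  qed
  moreover have "inj_on g ?G"
  proof (rule inj_onI)
    fix i j assume ij: "i \<in> ?G" "j \<in> ?G" "g i = g j"
    then have "B (g i) (g j) = -1" using fg(5)[rule_format, of i i] by auto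
    then show "i = j" using fg(5)[rule_format, of i j] ij by (auto split: if_splits)
  qed
  moreover have "f ` ?F \<subseteq> {s\<in>S. B s s = 1}" "g ` ?G \<subseteq> {s\<in>S. B s s = -1}"
    using S(1) fg(4,5) by auto
  ultimately show thesis using that[of f g S] fg(1-3) S(2,3) by blast
qed

text \<open>The indices with nonnegative norm inject into the p positive basis vectors and those
  with nonpositive norm into the q negative ones; a null vector is counted on both sides.\<close>

lemma orth_family_card_le:
  assumes B: "has_signature p q B" and I: "finite I" "orth_family B I x \<epsilon>"
  shows "card {i\<in>I. \<epsilon> i \<ge> 0} \<le> p" "card {i\<in>I. \<epsilon> i \<le> 0} \<le> q"
proof -
  have B': "sym_form B" "nondegenerate B" "n_pos_eig B = p" "n_neg_eig B = q"
    using B unfolding has_signature_def by auto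
  obtain f g S where "\<forall>i\<in>I. x i = f i + g i"
    "\<forall>i\<in>I. \<epsilon> i < 0 \<longrightarrow> f i = 0" "\<forall>i\<in>I. \<epsilon> i > 0 \<longrightarrow> g i = 0"
    and S: "pseudo_orthonormal B S" "span S = UNIV" "inj_on f {i\<in>I. \<epsilon> i \<ge> 0}" "inj_on g {i\<in>I. \<epsilon> i \<le> 0}"
    "f ` {i\<in>I. \<epsilon> i \<ge> 0} \<subseteq> {s\<in>S. B s s = 1}" "g ` {i\<in>I. \<epsilon> i \<le> 0} \<subseteq> {s\<in>S. B s s = -1}"
    using orth_family_extend_to_basis[OF B'(1,2) I] by blast
  have "finite S" using pseudo_orthonormal_finite[OF B'(1) S(1)] .
  then show "card {i\<in>I. \<epsilon> i \<ge> 0} \<le> p" "card {i\<in>I. \<epsilon> i \<le> 0} \<le> q"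
    using card_inj_on_le[OF S(3,5)] card_inj_on_le[OF S(4,6)] pseudo_orthonormal_basis_card_eig[OF B'(1,2) S(1,2)] B'(3,4)
    by simp_all
qed

section \<open>Extending and constructing isometric families\<close>

lemma bij_betw_extend:
  assumes fin: "finite A" "finite C" "card A = card C"
    and f: "inj_on f I" "f ` I \<subseteq> A" and g: "inj_on g I" "g ` I \<subseteq> C"
  obtains h where "bij_betw h A C" "\<And>i. i \<in> I \<Longrightarrow> h (f i) = g i"
proof -
  have "card (A - f ` I) = card (C - g ` I)"
    using fin f g by (simp add: card_Diff_subset finite_subset card_image)
  then obtain k where k: "bij_betw k (A - f ` I) (C - g ` I)"
    using finite_same_card_bij[of "A - f ` I" "C - g ` I"] fin by blast
  define h where "h a = (if a \<in> f ` I then g (the_inv_into I f a) else k a)" for a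
  have hf: "h (f i) = g i" if "i \<in> I" for i using that f(1) by (simp add: h_def the_inv_into_f_f)
  have "bij_betw h (f ` I) (g ` I)"
    unfolding bij_betw_def using hf g(1) f(1) by (auto simp: inj_on_def image_image)
  moreover have "bij_betw h (A - f ` I) (C - g ` I)"
    using k by (rule bij_betw_cong[THEN iffD1, rotated]) (auto simp: h_def)
  ultimately have "bij_betw h (f ` I \<union> (A - f ` I)) (g ` I \<union> (C - g ` I))"
    by (rule bij_betw_combine) blast
  moreover have "f ` I \<union> (A - f ` I) = A" "g ` I \<union> (C - g ` I) = C" using f g by auto
  ultimately show thesis using hf that by simp
qed

text \<open>Once both families are expressed in pseudo-orthonormal bases, any bijection of the bases
  that preserves signs and matches the prescribed members extends linearly to an isometry. The basis
  vectors outside the families may be matched arbitrarily, since the signature makes their numbers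
  agree.\<close>

lemma witt_extension:
  fixes B1 B2 :: "'a::euclidean_space \<Rightarrow> 'a \<Rightarrow> real"
  assumes B1: "has_signature p q B1" and B2: "has_signature p q B2"
    and I: "finite I" and x: "orth_family B1 I x \<epsilon>" and y: "orth_family B2 I y \<epsilon>"
  obtains A where "linear A" "\<And>u v. B2 (A u) (A v) = B1 u v" "\<And>i. i \<in> I \<Longrightarrow> A (x i) = y i"
proof -
  have B: "sym_form B1" "nondegenerate B1" "n_pos_eig B1 = p" "n_neg_eig B1 = q"
    "sym_form B2" "nondegenerate B2" "n_pos_eig B2 = p" "n_neg_eig B2 = q"
    using B1 B2 unfolding has_signature_def by auto
  let ?F = "{i\<in>I. \<epsilon> i \<ge> 0}" and ?G = "{i\<in>I. \<epsilon> i \<le> 0}"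
  obtain f g S where S: "\<forall>i\<in>I. x i = f i + g i"
    "\<forall>i\<in>I. \<epsilon> i < 0 \<longrightarrow> f i = 0" "\<forall>i\<in>I. \<epsilon> i > 0 \<longrightarrow> g i = 0"
    "pseudo_orthonormal B1 S" "span S = UNIV" "inj_on f ?F" "inj_on g ?G"
    "f ` ?F \<subseteq> {s\<in>S. B1 s s = 1}" "g ` ?G \<subseteq> {s\<in>S. B1 s s = -1}"
    using orth_family_extend_to_basis[OF B(1,2) I x] by blast
  obtain f' g' S' where S': "\<forall>i\<in>I. y i = f' i + g' i"
    "\<forall>i\<in>I. \<epsilon> i < 0 \<longrightarrow> f' i = 0" "\<forall>i\<in>I. \<epsilon> i > 0 \<longrightarrow> g' i = 0"
    "pseudo_orthonormal B2 S'" "span S' = UNIV" "inj_on f' ?F" "inj_on g' ?G"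
    "f' ` ?F \<subseteq> {s\<in>S'. B2 s s = 1}" "g' ` ?G \<subseteq> {s\<in>S'. B2 s s = -1}"
    using orth_family_extend_to_basis[OF B(5,6) I y] by blast
  have fin: "finite S" "finite S'" using pseudo_orthonormal_finite B S S' by blast+
  obtain h1 where h1: "bij_betw h1 {s\<in>S. B1 s s = 1} {s\<in>S'. B2 s s = 1}" "\<And>i. i \<in> ?F \<Longrightarrow> h1 (f i) = f' i"
    using bij_betw_extend[OF _ _ _ S(6,8) S'(6,8)] fin pseudo_orthonormal_basis_card_eig[OF B(1,2) S(4,5)]
      pseudo_orthonormal_basis_card_eig[OF B(5,6) S'(4,5)] B by auto
  obtain h2 where h2: "bij_betw h2 {s\<in>S. B1 s s = -1} {s\<in>S'. B2 s s = -1}" "\<And>i. i \<in> ?G \<Longrightarrow> h2 (g i) = g' i"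
    using bij_betw_extend[OF _ _ _ S(7,9) S'(7,9)] fin pseudo_orthonormal_basis_card_eig[OF B(1,2) S(4,5)]
      pseudo_orthonormal_basis_card_eig[OF B(5,6) S'(4,5)] B by auto
  \<comment> \<open>On S a norm other than 1 is -1, so the sign selects the bijection.\<close>
  define h where "h s = (if B1 s s = 1 then h1 s else h2 s)" for s
  obtain A where A: "linear A" "\<And>s. s \<in> S \<Longrightarrow> A s = h s"
    using linear_independent_extend[OF pseudo_orthonormal_independent[OF B(1) S(4)], of h] by blast
  have pos: "h s \<in> S' \<and> B2 (h s) (h s) = 1" if "s \<in> S" "B1 s s = 1" for s
    using bij_betwE[OF h1(1)] that unfolding h_def by simp
  have neg: "h s \<in> S' \<and> B2 (h s) (h s) = -1" if "s \<in> S" "B1 s s = -1" for s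
    using bij_betwE[OF h2(1)] that unfolding h_def by simp
  have inj: "h s \<noteq> h t" if st: "s \<in> S" "t \<in> S" "s \<noteq> t" for s t
  proof
    assume eq: "h s = h t"
    have "B1 s s = 1 \<or> B1 s s = -1" "B1 t t = 1 \<or> B1 t t = -1" using S(4) st unfolding pseudo_orthonormal_def by auto
    moreover have "inj_on h1 {s\<in>S. B1 s s = 1}" "inj_on h2 {s\<in>S. B1 s s = -1}"
      using h1 h2 bij_betw_imp_inj_on by blast+
    ultimately show False
      using eq st pos[of s] pos[of t] neg[of s] neg[of t] unfolding h_def inj_on_def by (auto split: if_splits)
  qed
  have iso_S: "B2 (h s) (h t) = B1 s t" if "s \<in> S" "t \<in> S" for s t
  proof (cases "s = t")
    case True
    then show ?thesis using pos[of s] neg[of s] S(4) that unfolding pseudo_orthonormal_def by metis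
  next
    case False
    then have "B1 s t = 0" using S(4) that unfolding pseudo_orthonormal_def by blast
    moreover have "h s \<in> S'" "h t \<in> S'" using pos neg S(4) that unfolding pseudo_orthonormal_def by metis+
    ultimately show ?thesis using inj[OF that False] S'(4) unfolding pseudo_orthonormal_def by simp
  qed
  have iso: "B2 (A u) (A v) = B1 u v" for u v
  proof -
    obtain c d where c: "u = (\<Sum>s\<in>S. c s *\<^sub>R s)" and d: "v = (\<Sum>s\<in>S. d s *\<^sub>R s)"
      using S(5) span_finite[OF fin(1)] by blast
    show ?thesis unfolding c d using iso_S A(2)
      by (simp add: linear_sum[OF A(1)] linear_scale[OF A(1)] sym_form_sum[OF B(1)] sym_form_sum[OF B(5)]
          sym_form_simps[OF B(1)] sym_form_simps[OF B(5)])
  qed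
  moreover have "A (x i) = y i" if i: "i \<in> I" for i
  proof -
    have "A (f i) = f' i"
    proof (cases "\<epsilon> i \<ge> 0")
      case True
      then have "f i \<in> S" "B1 (f i) (f i) = 1" using S(8) i by auto
      then show ?thesis using h1(2) True i A(2) unfolding h_def by simp
    next
      case False
      then show ?thesis using S(2) S'(2) i linear_0[OF A(1)] by simp
    qed
    moreover have "A (g i) = g' i"
    proof (cases "\<epsilon> i \<le> 0")
      case True
      then have "g i \<in> S" "B1 (g i) (g i) = -1" using S(9) i by auto
      then show ?thesis using h2(2) True i A(2) unfolding h_def by simp
    next
      case False
      then show ?thesis using S(3) S'(3) i linear_0[OF A(1)] by simp
    qed
    ultimately show ?thesis using S(1) S'(1) i linear_add[OF A(1)] by simp
  qed
  ultimately show thesis using that A(1) by blast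
qed

lemma isometry_bij:
  fixes A :: "'a::euclidean_space \<Rightarrow> 'a"
  assumes A: "linear A" and B: "sym_form B2" "nondegenerate B1" "\<And>u v. B2 (A u) (A v) = B1 u v"
  shows "bij A"
proof -
  have "inj A"
  proof (subst linear_injective_0[OF A], intro allI impI)
    fix x assume "A x = 0"
    then have "\<forall>y. B1 x y = 0" using B(3) sym_form_simps(9)[OF B(1)] by metis
    then show "x = 0" using B(2) unfolding nondegenerate_def by blast
  qed
  then show ?thesis using linear_injective_imp_surjective[OF A] unfolding bij_def by blast
qed

lemma has_signature_pullback:
  assumes B: "has_signature p q B" and A: "linear A" "bij A"
  shows "has_signature p q (\<lambda>x y. B (A x) (A y))"
proof -
  obtain S where S: "sym_form B" "pseudo_orthonormal B S" "span S = UNIV" "card {x\<in>S. B x x = 1} = p" "card {x\<in>S. B x x = -1} = q"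
    using B unfolding has_signature_iff_pseudo_orthonormal_basis by blast
  let ?C = "\<lambda>x y. B (A x) (A y)"
  have inj: "inj A" and surj: "surj A" using A(2) unfolding bij_def by auto
  have "sym_form ?C"
    unfolding sym_form_def bilinear_def linear_iff
    using sym_form_commute[OF S(1)] by (simp add: linear_add[OF A(1)] linear_scale[OF A(1)] sym_form_simps[OF S(1)])
  moreover define T where "T = A -` S"
  have im: "A ` T = S" unfolding T_def using surj by (simp add: surj_image_vimage_eq)
  have "pseudo_orthonormal ?C T" using S(2) inj unfolding pseudo_orthonormal_def T_def by (auto dest: injD)
  moreover have "span T = UNIV"
  proof -
    have "A ` span T = UNIV" using linear_span_image[OF A(1), of T] im S(3) by simp
    then show ?thesis using inj surj by (metis inj_image_eq_iff)
  qed
  moreover have "card {x\<in>T. ?C x x = r} = card {x\<in>S. B x x = r}" for r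
  proof -
    have "A ` {x\<in>T. ?C x x = r} = {x\<in>S. B x x = r}" using im by auto
    moreover have "inj_on A {x\<in>T. ?C x x = r}" using inj by (rule inj_on_subset) simp
    ultimately show ?thesis using card_image by fastforce
  qed
  ultimately show ?thesis unfolding has_signature_iff_pseudo_orthonormal_basis using S(4,5) by blast
qed

text \<open>In the diagonal form with p entries 1 and q entries -1, the indices with nonnegative
  norm get distinct positive basis vectors and those with nonpositive norm distinct negative ones. A
  null index gets one of each kind and is realised by their sum, so the cardinality bounds
  suffice.\<close>

lemma model_form_orth_family_exists:
  fixes \<epsilon> :: "'i \<Rightarrow> real"
  assumes pq: "p + q = DIM('a::euclidean_space)"
    and I: "finite I" "\<And>i. i \<in> I \<Longrightarrow> \<epsilon> i \<in> {-1, 0, 1}" "card {i\<in>I. \<epsilon> i \<ge> 0} \<le> p" "card {i\<in>I. \<epsilon> i \<le> 0} \<le> q"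
  obtains B :: "'a::euclidean_space \<Rightarrow> 'a \<Rightarrow> real" and x where "has_signature p q B" "orth_family B I x \<epsilon>"
proof -
  obtain P :: "'a set" where P: "P \<subseteq> Basis" "card P = p" 
    using obtain_subset_with_card_n[of p "Basis :: 'a set"] pq by (metis le_add1)
  have "finite P" using P finite_subset finite_Basis by blast
  define s where "s b = (if b \<in> P then 1 else -1 :: real)" for b
  define B where "B u v = (\<Sum>b\<in>Basis. s b * ((u \<bullet> b) * (v \<bullet> b)))" for u v :: 'a
  have sym: "sym_form B"
    unfolding sym_form_def bilinear_def linear_iff B_def
    by (auto simp: inner_add_left sum.distrib sum_distrib_left algebra_simps)
  note ba = sym_form_simps[OF sym] and bs = sym_form_sum[OF sym] and bc = sym_form_commute[OF sym]
  have Bb: "B u v = (if u = v then s u else 0)" if "u \<in> Basis" "v \<in> Basis" for u v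
  proof -
    have "B u v = (\<Sum>b\<in>Basis. if b = u then (if u = v then s u else 0) else 0)"
      unfolding B_def using that by (intro sum.cong) (auto simp: inner_Basis)
    then show ?thesis using that by simp
  qed
  have pon: "pseudo_orthonormal B Basis" unfolding pseudo_orthonormal_def using Bb by (auto simp: s_def)
  have "{b\<in>Basis. B b b = 1} = P" "{b\<in>Basis. B b b = -1} = Basis - P"
    using P Bb by (auto simp: s_def split: if_splits)
  then have sig: "has_signature p q B"
    unfolding has_signature_iff_pseudo_orthonormal_basis using sym pon P pq \<open>finite P\<close>
    by (intro conjI exI[of _ Basis]) (auto simp: card_Diff_subset)
  obtain f where f: "f ` {i\<in>I. \<epsilon> i \<ge> 0} \<subseteq> P" "inj_on f {i\<in>I. \<epsilon> i \<ge> 0}"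
    using card_le_inj[of "{i\<in>I. \<epsilon> i \<ge> 0}" P] I P \<open>finite P\<close> by auto
  obtain g where g: "g ` {i\<in>I. \<epsilon> i \<le> 0} \<subseteq> Basis - P" "inj_on g {i\<in>I. \<epsilon> i \<le> 0}"
  proof -
    have "card (Basis - P) = q" using P pq \<open>finite P\<close> by (simp add: card_Diff_subset)
    then show thesis using card_le_inj[of "{i\<in>I. \<epsilon> i \<le> 0}" "Basis - P"] I that by auto
  qed
  define x where "x i = (if \<epsilon> i = 1 then f i else if \<epsilon> i = -1 then g i else f i + g i)" for i
  have ff: "B (f i) (f j) = (if i = j then 1 else 0)" if "i \<in> I" "j \<in> I" "\<epsilon> i \<ge> 0" "\<epsilon> j \<ge> 0" for i j
  proof -
    have "f i \<in> P" "f j \<in> P" using f(1) that by auto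
    moreover have "f i = f j \<longleftrightarrow> i = j" using f(2) that unfolding inj_on_def by auto
    ultimately show ?thesis using Bb[of "f i" "f j"] subsetD[OF P(1), of "f i"] subsetD[OF P(1), of "f j"]
      by (auto simp: s_def)
  qed
  have gg: "B (g i) (g j) = (if i = j then -1 else 0)" if "i \<in> I" "j \<in> I" "\<epsilon> i \<le> 0" "\<epsilon> j \<le> 0" for i j
  proof -
    have "g i \<in> Basis - P" "g j \<in> Basis - P" using g(1) that by auto
    moreover have "g i = g j \<longleftrightarrow> i = j" using g(2) that unfolding inj_on_def by auto
    ultimately show ?thesis using Bb[of "g i" "g j"] P by (auto simp: s_def)
  qed
  have fg: "B (f i) (g j) = 0" "B (g j) (f i) = 0" if "i \<in> I" "j \<in> I" "\<epsilon> i \<ge> 0" "\<epsilon> j \<le> 0" for i j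
  proof -
    have "f i \<in> P" "g j \<in> Basis - P" using f(1) g(1) that by auto
    then show "B (f i) (g j) = 0" "B (g j) (f i) = 0" using Bb subsetD[OF P(1), of "f i"] by force+
  qed
  have xx: "B (x i) (x j) = (if i = j then \<epsilon> i else 0)" if "i \<in> I" "j \<in> I" for i j
    using I(2)[OF that(1)] I(2)[OF that(2)] ff[OF that] gg[OF that] fg[OF that] fg[OF that(2,1)]
    unfolding x_def by (auto simp: ba)
  have "lin_indep_family I x"
    unfolding lin_indep_family_def
  proof (intro allI impI ballI)
    fix c i assume c: "(\<Sum>k\<in>I. c k *\<^sub>R x k) = 0" and i: "i \<in> I"
    \<comment> \<open>A test vector that isolates the coefficient of \<open>x i\<close>. Pairing
      with \<open>x i\<close> itself would fail for a null vector, whereas pairing with one of its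
      unit parts gives 1 or -1.\<close>
    define y where "y = (if \<epsilon> i \<ge> 0 then f i else g i)"
    have y: "B (x k) y = (if k = i then B (x i) y else 0)" if "k \<in> I" for k
      using I(2)[OF that] I(2)[OF i] ff[OF that i] gg[OF that i] fg[OF that i] fg[OF i that]
      unfolding x_def y_def by (auto simp: ba)
    have "0 = (\<Sum>k\<in>I. c k * B (x k) y)" using c ba(9) bs(1)[of "\<lambda>k. c k *\<^sub>R x k" I y] by (simp add: ba)
    also have "\<dots> = (\<Sum>k\<in>I. if k = i then c i * B (x i) y else 0)" using y by (intro sum.cong) auto
    also have "\<dots> = c i * B (x i) y" using I(1) i by simp
    finally have "c i * B (x i) y = 0" by simp
    moreover have "B (x i) y \<noteq> 0"
      using I(2)[OF i] ff[OF i i] gg[OF i i] fg[OF i i] unfolding x_def y_def by (auto simp: ba)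
    ultimately show "c i = 0" by simp
  qed
  with xx I(2) have "orth_family B I x \<epsilon>" unfolding orth_family_def by blast
  with sig that show thesis by blast
qed

section \<open>Forms relative to a flag\<close>

lemma det2_eq_0:
  fixes u v \<alpha> \<beta> \<gamma> \<delta> :: real
  assumes "\<alpha> * \<delta> - \<beta> * \<gamma> \<noteq> 0" "\<alpha> * u + \<beta> * v = 0" "\<gamma> * u + \<delta> * v = 0"
  shows "u = 0 \<and> v = 0"
proof -
  have "(\<alpha> * \<delta> - \<beta> * \<gamma>) * u = 0" "(\<alpha> * \<delta> - \<beta> * \<gamma>) * v = 0" using assms(2,3) by algebra+
  then show ?thesis using assms(1) by simp
qed

definition indep2 :: "'a::real_vector \<Rightarrow> 'a \<Rightarrow> bool" where
  "indep2 u v \<longleftrightarrow> (\<forall>\<alpha> \<beta>. \<alpha> *\<^sub>R u + \<beta> *\<^sub>R v = 0 \<longrightarrow> \<alpha> = 0 \<and> \<beta> = 0)"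

lemma lin_indep_family_2: "lin_indep_family {0, 1::nat} x \<longleftrightarrow> indep2 (x 0) (x 1)"
proof
  assume L: "lin_indep_family {0, 1::nat} x"
  show "indep2 (x 0) (x 1)"
    unfolding indep2_def
  proof (intro allI impI)
    fix \<alpha> \<beta> assume "\<alpha> *\<^sub>R x 0 + \<beta> *\<^sub>R x 1 = 0"
    then show "\<alpha> = 0 \<and> \<beta> = 0"
      using L[unfolded lin_indep_family_def, rule_format, of "\<lambda>i. if i = 0 then \<alpha> else \<beta>"] by force
  qed
qed (auto simp: lin_indep_family_def indep2_def)

text \<open>In a tuple \<open>(c, s, t1, t2)\<close>, the truth value \<open>c\<close> says that the line vector lies in the polar plane, \<open>s\<close> is the
  sign of its norm, and \<open>t1\<close>, \<open>t2\<close> are the norms of an orthogonal basis of the plane. If \<open>c\<close> holds, the line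
  vector is not a further member of the frame but spans the line of a null basis vector.\<close>
definition frame_norm :: "real \<Rightarrow> real \<Rightarrow> real \<Rightarrow> nat \<Rightarrow> real" where
  "frame_norm s t1 t2 i = (if i = 0 then t1 else if i = 1 then t2 else s)"

definition frame_index :: "bool \<Rightarrow> nat set" where
  "frame_index c = (if c then {0, 1} else {0, 1, 2})"

text \<open>For c with \<open>t1\<close> nonzero, validity forces \<open>t2 = 0\<close>, so the line
  is spanned by the second basis vector. If both norms vanish the plane is totally null, and the
  basis can be chosen so that the line comes first.\<close>

definition line_index :: "bool \<Rightarrow> real \<Rightarrow> nat" where
  "line_index c t1 = (if \<not> c then 2 else if t1 = 0 then 0 else 1)"

text \<open>Ordering the two norms removes the freedom to exchange the basis vectors. The clause for
  c reflects that a line vector in the polar plane also lies in Z, hence in the radical of the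
  plane.\<close>

definition valid_profile :: "bool \<times> real \<times> real \<times> real \<Rightarrow> bool" where
  "valid_profile = (\<lambda>(c, s, t1, t2). {s, t1, t2} \<subseteq> {-1, 0, 1} \<and> t2 \<le> t1 \<and> (c \<longrightarrow> s = 0 \<and> (t1 = 0 \<or> t2 = 0)))"

definition fits_signature :: "nat \<Rightarrow> nat \<Rightarrow> bool \<times> real \<times> real \<times> real \<Rightarrow> bool" where
  "fits_signature p q = (\<lambda>(c, s, t1, t2).
     card {i \<in> frame_index c. frame_norm s t1 t2 i \<ge> 0} \<le> p \<and> card {i \<in> frame_index c. frame_norm s t1 t2 i \<le> 0} \<le> q)"

lemma normalizing_scalar:
  obtains r :: real where "r > 0" "r * (r * t) = sgn t"
proof (cases "t = 0")
  case False
  have "(1 / sqrt \<bar>t\<bar>) * ((1 / sqrt \<bar>t\<bar>) * t) = t / (sqrt \<bar>t\<bar> * sqrt \<bar>t\<bar>)" by simp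
  also have "\<dots> = sgn t" using False by (simp add: sgn_if)
  finally show thesis using that[of "1 / sqrt \<bar>t\<bar>"] False by simp
qed (use that[of 1] in simp)

lemma lin_indep_family_3:
  assumes "indep2 (x 0) (x 1)" "\<nexists>\<alpha> \<beta>. x 2 = \<alpha> *\<^sub>R x 0 + \<beta> *\<^sub>R x 1"
  shows "lin_indep_family {0, 1, 2::nat} x"
  unfolding lin_indep_family_def
proof (intro allI impI)
  fix c :: "nat \<Rightarrow> real" assume "(\<Sum>i\<in>{0, 1, 2}. c i *\<^sub>R x i) = 0"
  then have eq: "c 0 *\<^sub>R x 0 + c 1 *\<^sub>R x 1 + c 2 *\<^sub>R x 2 = 0" by (simp add: add.assoc)
  have "c 2 = 0"
  proof (rule ccontr)
    assume nz: "c 2 \<noteq> 0"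
    have "c 2 *\<^sub>R x 2 = (- c 0) *\<^sub>R x 0 + (- c 1) *\<^sub>R x 1"
      using eq by (simp add: eq_neg_iff_add_eq_0 algebra_simps)
    then have "(1 / c 2) *\<^sub>R (c 2 *\<^sub>R x 2) = (1 / c 2) *\<^sub>R ((- c 0) *\<^sub>R x 0 + (- c 1) *\<^sub>R x 1)" by simp
    then have "x 2 = (- c 0 / c 2) *\<^sub>R x 0 + (- c 1 / c 2) *\<^sub>R x 1"
      using nz by (simp add: scaleR_add_right scaleR_diff_right)
    then show False using assms(2) by blast
  qed
  moreover from this have "c 0 = 0 \<and> c 1 = 0" using eq assms(1) unfolding indep2_def by auto
  ultimately show "\<forall>i\<in>{0, 1, 2}. c i = 0" by auto
qed

lemma finite_frame_index: "finite (frame_index c)"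
  unfolding frame_index_def by auto

text \<open>Treating the Euclidean inner product as one more form lets \<open>witt_extension\<close>
  supply an orthogonal map between two orthonormal triples.\<close>

lemma has_signature_inner: "\<exists>m n. has_signature m n ((\<bullet>) :: 'a::euclidean_space \<Rightarrow> 'a \<Rightarrow> real)"
proof -
  have "sym_form ((\<bullet>) :: 'a \<Rightarrow> 'a \<Rightarrow> real)"
    unfolding sym_form_def bilinear_def linear_iff by (auto simp: inner_add_left inner_add_right inner_commute)
  moreover have "nondegenerate ((\<bullet>) :: 'a \<Rightarrow> 'a \<Rightarrow> real)" unfolding nondegenerate_def by (metis inner_eq_zero_iff)
  ultimately show ?thesis unfolding has_signature_def by blast
qed

lemma orthonormal_triple_orth_family:
  fixes u v w :: "'a::euclidean_space"
  assumes "u \<bullet> u = 1" "v \<bullet> v = 1" "w \<bullet> w = 1" "u \<bullet> v = 0" "u \<bullet> w = 0" "v \<bullet> w = 0"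
  shows "orth_family (\<bullet>) {0, 1, 2::nat} (\<lambda>i. if i = 0 then u else if i = 1 then v else w) (\<lambda>_. 1)"
proof -
  let ?x = "\<lambda>i::nat. if i = 0 then u else if i = 1 then v else w"
  have "lin_indep_family {0, 1, 2} ?x"
    unfolding lin_indep_family_def
  proof (intro allI impI)
    fix c :: "nat \<Rightarrow> real" assume "(\<Sum>i\<in>{0, 1, 2}. c i *\<^sub>R ?x i) = 0"
    then have eq: "c 0 *\<^sub>R u + c 1 *\<^sub>R v + c 2 *\<^sub>R w = 0" by (simp add: add.assoc)
    have "y \<bullet> (c 0 *\<^sub>R u + c 1 *\<^sub>R v + c 2 *\<^sub>R w) = 0" for y unfolding eq by simp
    from this[of u] this[of v] this[of w] show "\<forall>i\<in>{0, 1, 2}. c i = 0"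
      using assms by (simp add: inner_add_right inner_commute[of v u] inner_commute[of w u] inner_commute[of w v])
  qed
  then show ?thesis unfolding orth_family_def using assms by (auto simp: inner_commute)
qed

lemma gram_schmidt_2:
  fixes u v :: "'a::euclidean_space"
  assumes "indep2 u v"
  obtains u' v' where "u' \<bullet> u' = 1" "v' \<bullet> v' = 1" "u' \<bullet> v' = 0"
    "\<And>z. z \<bullet> u = 0 \<and> z \<bullet> v = 0 \<longleftrightarrow> z \<bullet> u' = 0 \<and> z \<bullet> v' = 0"
proof -
  have "1 *\<^sub>R u + 0 *\<^sub>R v = 0 \<longrightarrow> False" using assms unfolding indep2_def by fastforce
  then have u: "u \<noteq> 0" by auto
  define v0 where "v0 = v - ((v \<bullet> u) / (u \<bullet> u)) *\<^sub>R u"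
  have uu: "u \<bullet> u \<noteq> 0" using u by simp
  have v0: "v0 \<noteq> 0"
  proof
    assume "v0 = 0"
    then have "(- ((v \<bullet> u) / (u \<bullet> u))) *\<^sub>R u + 1 *\<^sub>R v = 0" unfolding v0_def by simp
    then show False using assms unfolding indep2_def by fastforce
  qed
  have "v0 \<bullet> u = 0" unfolding v0_def using uu by (simp add: inner_diff_left)
  then have uv0: "u \<bullet> v0 = 0" by (simp add: inner_commute)
  have zv: "z \<bullet> v0 = z \<bullet> v" if "z \<bullet> u = 0" for z unfolding v0_def using that by (simp add: inner_diff_right)
  show thesis
    using u v0 uv0 zv by (intro that[of "(1 / norm u) *\<^sub>R u" "(1 / norm v0) *\<^sub>R v0"]) (auto simp: dot_square_norm power2_eq_square)
qed

text \<open>For the group, e spans the derived line, and a and b are Euclidean normals of the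
  centre. Orthonormality concerns the fixed Euclidean structure only; it says nothing about the form
  \<open>B\<close> under study.\<close>

locale flag =
  fixes e a b :: "'a::euclidean_space"
  assumes orthonormal: "e \<bullet> e = 1" "a \<bullet> a = 1" "b \<bullet> b = 1" "e \<bullet> a = 0" "e \<bullet> b = 0" "a \<bullet> b = 0"
begin

definition Z :: "'a set" where
  "Z = {z. z \<bullet> a = 0 \<and> z \<bullet> b = 0}"

definition polar :: "('a \<Rightarrow> 'a \<Rightarrow> real) \<Rightarrow> 'a set" where
  "polar B = {x. \<forall>z\<in>Z. B z x = 0}"

text \<open>This is a basis of the polar plane, expressed by the equations it imposes on Z. An
  isometry that carries one adapted pair to another then preserves Z at once.\<close>

definition adapted :: "('a \<Rightarrow> 'a \<Rightarrow> real) \<Rightarrow> 'a \<Rightarrow> 'a \<Rightarrow> bool" where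
  "adapted B p1 p2 \<longleftrightarrow> indep2 p1 p2 \<and> Z = {z. B z p1 = 0 \<and> B z p2 = 0}"

text \<open>A relation, because the norms come from a choice of basis. \<open>profile_exists\<close>
  and \<open>profile_unique\<close> make it a function on nondegenerate symmetric forms.\<close>

definition profile :: "('a \<Rightarrow> 'a \<Rightarrow> real) \<Rightarrow> bool \<times> real \<times> real \<times> real \<Rightarrow> bool" where
  "profile B = (\<lambda>(c, s, t1, t2). (c \<longleftrightarrow> e \<in> polar B) \<and> s = sgn (B e e) \<and>
     (\<exists>p1 p2. adapted B p1 p2 \<and> B p1 p2 = 0 \<and> B p1 p1 = t1 \<and> B p2 p2 = t2) \<and>
     {t1, t2} \<subseteq> {-1, 0, 1} \<and> t2 \<le> t1)"

lemma e_in_Z: "e \<in> Z" and e_nonzero: "e \<noteq> 0"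
  using orthonormal unfolding Z_def by auto

text \<open>Subtracting from z its components along the vectors dual to \<open>p1\<close> and
  \<open>p2\<close> leaves an element of Z, which x annihilates. Hence x pairs with every z as a
  combination of \<open>p1\<close> and \<open>p2\<close> does, and nondegeneracy identifies the
  two.\<close>

lemma polar_adapted_iff:
  assumes B: "sym_form B" "nondegenerate B" and ad: "adapted B p1 p2"
  shows "x \<in> polar B \<longleftrightarrow> (\<exists>\<alpha> \<beta>. x = \<alpha> *\<^sub>R p1 + \<beta> *\<^sub>R p2)"
proof
  note ba = sym_form_simps[OF B(1)]
  assume x: "x \<in> polar B"
  define y where "y i = (if i = 0 then p1 else p2)" for i :: nat
  have "lin_indep_family {0, 1} y" using ad unfolding adapted_def lin_indep_family_2 y_def by simp
  then obtain w where w: "\<And>i j. i \<in> {0, 1} \<Longrightarrow> j \<in> {0, 1} \<Longrightarrow> B (w i) (y j) = (if i = j then 1 else 0)"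
    using dual_family_exists[OF B, of "{0, 1}" y] by blast
  have w': "B (w 0) p1 = 1" "B (w 0) p2 = 0" "B (w 1) p1 = 0" "B (w 1) p2 = 1"
    using w[of 0 0] w[of 0 1] w[of 1 0] w[of 1 1] unfolding y_def by auto
  have "x = B (w 0) x *\<^sub>R p1 + B (w 1) x *\<^sub>R p2"
  proof (rule form_op_inj[OF B])
    fix z
    have "z - B z p1 *\<^sub>R w 0 - B z p2 *\<^sub>R w 1 \<in> Z" using ad w' unfolding adapted_def by (simp add: ba)
    then have "B (z - B z p1 *\<^sub>R w 0 - B z p2 *\<^sub>R w 1) x = 0" using x unfolding polar_def by blast
    then show "B z x = B z (B (w 0) x *\<^sub>R p1 + B (w 1) x *\<^sub>R p2)" by (simp add: ba algebra_simps)
  qed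
  then show "\<exists>\<alpha> \<beta>. x = \<alpha> *\<^sub>R p1 + \<beta> *\<^sub>R p2" by blast
next
  assume "\<exists>\<alpha> \<beta>. x = \<alpha> *\<^sub>R p1 + \<beta> *\<^sub>R p2"
  then show "x \<in> polar B" using ad unfolding adapted_def polar_def by (auto simp: sym_form_simps[OF B(1)])
qed

lemma adapted_change_basis:
  assumes B: "sym_form B" and ad: "adapted B p1 p2" and det: "\<alpha> * \<delta> - \<beta> * \<gamma> \<noteq> 0"
  shows "adapted B (\<alpha> *\<^sub>R p1 + \<beta> *\<^sub>R p2) (\<gamma> *\<^sub>R p1 + \<delta> *\<^sub>R p2)"
  unfolding adapted_def
proof
  show "indep2 (\<alpha> *\<^sub>R p1 + \<beta> *\<^sub>R p2) (\<gamma> *\<^sub>R p1 + \<delta> *\<^sub>R p2)"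
    unfolding indep2_def
  proof (intro allI impI)
    fix u v assume "u *\<^sub>R (\<alpha> *\<^sub>R p1 + \<beta> *\<^sub>R p2) + v *\<^sub>R (\<gamma> *\<^sub>R p1 + \<delta> *\<^sub>R p2) = 0"
    then have "(\<alpha> * u + \<gamma> * v) *\<^sub>R p1 + (\<beta> * u + \<delta> * v) *\<^sub>R p2 = 0" by (simp add: algebra_simps)
    then have "\<alpha> * u + \<gamma> * v = 0" "\<beta> * u + \<delta> * v = 0" using ad unfolding adapted_def indep2_def by blast+
    then show "u = 0 \<and> v = 0" using det2_eq_0[of \<alpha> \<delta> \<gamma> \<beta> u v] det by (simp add: mult.commute)
  qed
  show "Z = {z. B z (\<alpha> *\<^sub>R p1 + \<beta> *\<^sub>R p2) = 0 \<and> B z (\<gamma> *\<^sub>R p1 + \<delta> *\<^sub>R p2) = 0}"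
  proof -
    have "B z p1 = 0 \<and> B z p2 = 0 \<longleftrightarrow> \<alpha> * B z p1 + \<beta> * B z p2 = 0 \<and> \<gamma> * B z p1 + \<delta> * B z p2 = 0" for z
      using det2_eq_0[OF det, of "B z p1" "B z p2"] by auto
    then show ?thesis using ad unfolding adapted_def by (simp add: sym_form_simps[OF B])
  qed
qed

text \<open>Surjectivity of \<open>form_op\<close> turns the Euclidean normals a and b of Z into
  normals with respect to \<open>B\<close>.\<close>

lemma adapted_exists:
  assumes B: "sym_form B" "nondegenerate B"
  obtains p1 p2 where "adapted B p1 p2"
proof -
  obtain p1 p2 where p: "form_op B p1 = a" "form_op B p2 = b" using form_op_surj[OF B] by (metis surjD)
  have B1: "B z p1 = z \<bullet> a" and B2: "B z p2 = z \<bullet> b" for z using inner_form_op[OF B(1)] p by metis+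
  have "indep2 p1 p2"
    unfolding indep2_def
  proof (intro allI impI)
    fix u v assume *: "u *\<^sub>R p1 + v *\<^sub>R p2 = 0"
    have "B z (u *\<^sub>R p1 + v *\<^sub>R p2) = u * (z \<bullet> a) + v * (z \<bullet> b)" for z
      by (simp add: sym_form_simps[OF B(1)] B1 B2)
    then have "u * (z \<bullet> a) + v * (z \<bullet> b) = 0" for z using * sym_form_simps(10)[OF B(1)] by metis
    from this[of a] this[of b] show "u = 0 \<and> v = 0" using orthonormal by (simp add: inner_commute)
  qed
  then have "adapted B p1 p2" unfolding adapted_def Z_def B1 B2 by blast
  then show thesis using that by blast
qed

lemma adapted_orthogonal_exists:
  assumes B: "sym_form B" "nondegenerate B"
  obtains p1 p2 where "adapted B p1 p2" "B p1 p2 = 0"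
proof -
  note ba = sym_form_simps[OF B(1)]
  obtain p1 p2 where ad: "adapted B p1 p2" using adapted_exists[OF B] by blast
  have c: "B p2 p1 = B p1 p2" using sym_form_commute[OF B(1)] .
  \<comment> \<open>Gram-Schmidt needs a vector of nonzero norm. If both basis vectors are null,
    their sum and difference are orthogonal.\<close>
  consider "B p1 p1 \<noteq> 0" | "B p2 p2 \<noteq> 0" | "B p1 p1 = 0" "B p2 p2 = 0" by blast
  then show thesis
  proof cases
    case 1
    show thesis
      using that[OF adapted_change_basis[OF B(1) ad, of 1 1 0 "- (B p1 p2 / B p1 p1)"]] 1 by (simp add: ba)
  next
    case 2
    show thesis
      using that[OF adapted_change_basis[OF B(1) ad, of 1 1 "- (B p1 p2 / B p2 p2)" 0]] 2 by (simp add: ba)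
  next
    case 3
    show thesis using that[OF adapted_change_basis[OF B(1) ad, of 1 "-1" 1 1]] 3 c by (simp add: ba)
  qed
qed

lemma profile_exists:
  assumes B: "sym_form B" "nondegenerate B"
  obtains k where "profile B k"
proof -
  note ba = sym_form_simps[OF B(1)]
  obtain p1 p2 where p: "adapted B p1 p2" "B p1 p2 = 0" using adapted_orthogonal_exists[OF B] by blast
  have p21: "B p2 p1 = 0" using p(2) sym_form_commute[OF B(1)] by metis
  obtain r1 where r1: "r1 > 0" "r1 * (r1 * B p1 p1) = sgn (B p1 p1)" using normalizing_scalar by blast
  obtain r2 where r2: "r2 > 0" "r2 * (r2 * B p2 p2) = sgn (B p2 p2)" using normalizing_scalar by blast
  define v1 v2 where "v1 = r1 *\<^sub>R p1" and "v2 = r2 *\<^sub>R p2"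
  \<comment> \<open>Both orders are kept because a profile lists the larger norm first.\<close>
  have ad: "adapted B v1 v2" "adapted B v2 v1"
    using adapted_change_basis[OF B(1) p(1), of r1 r2 0 0] adapted_change_basis[OF B(1) p(1), of 0 0 r2 r1] r1(1) r2(1)
    unfolding v1_def v2_def by auto
  have v: "B v1 v2 = 0" "B v2 v1 = 0" "B v1 v1 = sgn (B p1 p1)" "B v2 v2 = sgn (B p2 p2)"
    using p(2) p21 r1 r2 unfolding v1_def v2_def by (simp_all add: ba)
  have s: "{B v1 v1, B v2 v2} \<subseteq> {-1, 0, 1}" unfolding v by (simp add: sgn_if)
  have "profile B (e \<in> polar B, sgn (B e e), B v1 v1, B v2 v2)" if "B v2 v2 \<le> B v1 v1"
    unfolding profile_def using that s ad v(1) by blast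
  moreover have "profile B (e \<in> polar B, sgn (B e e), B v2 v2, B v1 v1)" if "B v1 v1 \<le> B v2 v2"
    unfolding profile_def using that s ad v(2) by blast
  ultimately show thesis using that linear by metis
qed

text \<open>The left-hand sides depend on the plane alone, the right-hand sides on an orthogonal
  basis of it. So the set of signs that occur among the norms is independent of the basis.\<close>

lemma polar_invariants:
  assumes B: "sym_form B" "nondegenerate B" and p: "adapted B p1 p2" "B p1 p2 = 0"
  shows "(\<exists>x\<in>polar B. B x x > 0) \<longleftrightarrow> B p1 p1 > 0 \<or> B p2 p2 > 0"
    "(\<exists>x\<in>polar B. B x x < 0) \<longleftrightarrow> B p1 p1 < 0 \<or> B p2 p2 < 0"
    "(\<exists>x\<in>polar B. x \<noteq> 0 \<and> (\<forall>y\<in>polar B. B x y = 0)) \<longleftrightarrow> B p1 p1 = 0 \<or> B p2 p2 = 0"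
proof -
  note ba = sym_form_simps[OF B(1)]
  have p21: "B p2 p1 = 0" using p(2) sym_form_commute[OF B(1)] by metis
  have mem: "p1 \<in> polar B" "p2 \<in> polar B" using p(1) unfolding adapted_def polar_def by auto
  have nz: "p1 \<noteq> 0" "p2 \<noteq> 0" using p(1) unfolding adapted_def indep2_def
    by (metis add.right_neutral scaleR_zero_left scaleR_zero_right zero_neq_one,
        metis add.left_neutral scaleR_zero_left scaleR_zero_right zero_neq_one)
  have sq: "B (\<alpha> *\<^sub>R p1 + \<beta> *\<^sub>R p2) (\<alpha> *\<^sub>R p1 + \<beta> *\<^sub>R p2) = \<alpha>\<^sup>2 * B p1 p1 + \<beta>\<^sup>2 * B p2 p2" for \<alpha> \<beta>
    by (simp add: ba p p21 power2_eq_square)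
  have form: "\<exists>\<alpha> \<beta>. B x x = \<alpha>\<^sup>2 * B p1 p1 + \<beta>\<^sup>2 * B p2 p2" if "x \<in> polar B" for x
    using that sq unfolding polar_adapted_iff[OF B p(1)] by metis
  show "(\<exists>x\<in>polar B. B x x > 0) \<longleftrightarrow> B p1 p1 > 0 \<or> B p2 p2 > 0"
  proof
    assume "\<exists>x\<in>polar B. B x x > 0"
    then obtain \<alpha> \<beta> where *: "\<alpha>\<^sup>2 * B p1 p1 + \<beta>\<^sup>2 * B p2 p2 > 0" using form by metis
    show "B p1 p1 > 0 \<or> B p2 p2 > 0"
    proof (rule ccontr)
      assume "\<not> ?thesis"
      then have "\<alpha>\<^sup>2 * B p1 p1 \<le> 0" "\<beta>\<^sup>2 * B p2 p2 \<le> 0" by (auto simp: mult_nonneg_nonpos)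
      with * show False by linarith
    qed
  qed (use mem in blast)
  show "(\<exists>x\<in>polar B. B x x < 0) \<longleftrightarrow> B p1 p1 < 0 \<or> B p2 p2 < 0"
  proof
    assume "\<exists>x\<in>polar B. B x x < 0"
    then obtain \<alpha> \<beta> where *: "\<alpha>\<^sup>2 * B p1 p1 + \<beta>\<^sup>2 * B p2 p2 < 0" using form by metis
    show "B p1 p1 < 0 \<or> B p2 p2 < 0"
    proof (rule ccontr)
      assume "\<not> ?thesis"
      then have "\<alpha>\<^sup>2 * B p1 p1 \<ge> 0" "\<beta>\<^sup>2 * B p2 p2 \<ge> 0" by auto
      with * show False by linarith
    qed
  qed (use mem in blast)
  show "(\<exists>x\<in>polar B. x \<noteq> 0 \<and> (\<forall>y\<in>polar B. B x y = 0)) \<longleftrightarrow> B p1 p1 = 0 \<or> B p2 p2 = 0"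
  proof
    assume "\<exists>x\<in>polar B. x \<noteq> 0 \<and> (\<forall>y\<in>polar B. B x y = 0)"
    then obtain x where x: "x \<in> polar B" "x \<noteq> 0" "\<forall>y\<in>polar B. B x y = 0" by blast
    then obtain \<alpha> \<beta> where "x = \<alpha> *\<^sub>R p1 + \<beta> *\<^sub>R p2" using polar_adapted_iff[OF B p(1)] by blast
    with x have *: "\<alpha> *\<^sub>R p1 + \<beta> *\<^sub>R p2 \<noteq> 0" "\<forall>y\<in>polar B. B (\<alpha> *\<^sub>R p1 + \<beta> *\<^sub>R p2) y = 0" by simp_all
    have "\<alpha> * B p1 p1 = 0" "\<beta> * B p2 p2 = 0" using *(2) mem p p21 by (auto simp: ba)
    then show "B p1 p1 = 0 \<or> B p2 p2 = 0" using *(1) by auto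
  next
    assume "B p1 p1 = 0 \<or> B p2 p2 = 0"
    then show "\<exists>x\<in>polar B. x \<noteq> 0 \<and> (\<forall>y\<in>polar B. B x y = 0)"
    proof
      assume "B p1 p1 = 0"
      then have "\<forall>y\<in>polar B. B p1 y = 0" using p(2) polar_adapted_iff[OF B p(1)] by (auto simp: ba)
      then show ?thesis using mem nz by blast
    next
      assume "B p2 p2 = 0"
      then have "\<forall>y\<in>polar B. B p2 y = 0" using p21 polar_adapted_iff[OF B p(1)] by (auto simp: ba)
      then show ?thesis using mem nz by blast
    qed
  qed
qed

lemma profile_unique:
  assumes B: "sym_form B" "nondegenerate B" and k: "profile B k" "profile B k'"
  shows "k = k'"
proof -
  obtain c s t1 t2 where k1: "k = (c, s, t1, t2)" by (metis prod_cases4)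
  obtain c' s' u1 u2 where k2: "k' = (c', s', u1, u2)" by (metis prod_cases4)
  obtain p1 p2 where p: "adapted B p1 p2" "B p1 p2 = 0" "B p1 p1 = t1" "B p2 p2 = t2"
    using k(1) unfolding profile_def k1 by auto
  obtain r1 r2 where r: "adapted B r1 r2" "B r1 r2 = 0" "B r1 r1 = u1" "B r2 r2 = u2"
    using k(2) unfolding profile_def k2 by auto
  have cs: "c = c'" "s = s'" and t: "t1 \<in> {-1,0,1}" "t2 \<in> {-1,0,1}" "t2 \<le> t1" "u1 \<in> {-1,0,1}" "u2 \<in> {-1,0,1}" "u2 \<le> u1"
    using k unfolding profile_def k1 k2 by auto
  have "t1 > 0 \<or> t2 > 0 \<longleftrightarrow> u1 > 0 \<or> u2 > 0" "t1 < 0 \<or> t2 < 0 \<longleftrightarrow> u1 < 0 \<or> u2 < 0" "t1 = 0 \<or> t2 = 0 \<longleftrightarrow> u1 = 0 \<or> u2 = 0"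
    using polar_invariants[OF B p(1,2)] polar_invariants[OF B r(1,2)] p(3,4) r(3,4) by simp_all
  \<comment> \<open>A decreasing pair with entries in {-1, 0, 1} is determined by the set of values
    that occur in it.\<close>
  with t have "t1 = u1 \<and> t2 = u2" unfolding insert_iff empty_iff by (elim disjE) simp_all
  with cs show ?thesis unfolding k1 k2 by simp
qed

section \<open>Frames adapted to the flag, and the flag stabiliser\<close>

definition adapted_frame :: "('a \<Rightarrow> 'a \<Rightarrow> real) \<Rightarrow> bool \<times> real \<times> real \<times> real \<Rightarrow> (nat \<Rightarrow> 'a) \<Rightarrow> bool" where
  "adapted_frame B = (\<lambda>(c, s, t1, t2) x. orth_family B (frame_index c) x (frame_norm s t1 t2) \<and>
     adapted B (x 0) (x 1) \<and> (\<exists>m. m \<noteq> 0 \<and> e = m *\<^sub>R x (line_index c t1)))"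

text \<open>Since e lies in Z, it is orthogonal to the polar plane. Inside the plane it is therefore
  in the radical, so its coefficient at a basis vector of nonzero norm vanishes.\<close>

lemma line_in_polar:
  assumes B: "sym_form B" "nondegenerate B" and p: "adapted B p1 p2" "B p1 p2 = 0" and e: "e \<in> polar B"
  obtains \<alpha> \<beta> where "e = \<alpha> *\<^sub>R p1 + \<beta> *\<^sub>R p2" "\<alpha> * B p1 p1 = 0" "\<beta> * B p2 p2 = 0" "\<alpha> \<noteq> 0 \<or> \<beta> \<noteq> 0" "B e e = 0"
proof -
  note ba = sym_form_simps[OF B(1)]
  have p21: "B p2 p1 = 0" using p(2) sym_form_commute[OF B(1)] by metis
  obtain \<alpha> \<beta> where ab: "e = \<alpha> *\<^sub>R p1 + \<beta> *\<^sub>R p2" using e polar_adapted_iff[OF B p(1)] by blast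
  have "B e p1 = 0" "B e p2 = 0" using e_in_Z p(1) unfolding adapted_def by auto
  moreover have "B e p1 = \<alpha> * B p1 p1" "B e p2 = \<beta> * B p2 p2" unfolding ab by (simp_all add: ba p p21)
  moreover have "B e e = 0" using e e_in_Z unfolding polar_def by blast
  ultimately show thesis using that ab e_nonzero by fastforce
qed

lemma profile_valid:
  assumes B: "sym_form B" "nondegenerate B" and k: "profile B k"
  shows "valid_profile k"
proof -
  obtain c s t1 t2 where k1: "k = (c, s, t1, t2)" by (metis prod_cases4)
  obtain p1 p2 where p: "adapted B p1 p2" "B p1 p2 = 0" "B p1 p1 = t1" "B p2 p2 = t2"
    using k unfolding profile_def k1 by auto
  have c: "c \<longleftrightarrow> e \<in> polar B" "s = sgn (B e e)" and t: "{t1, t2} \<subseteq> {-1, 0, 1}" "t2 \<le> t1"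
    using k unfolding profile_def k1 by auto
  have "s = 0 \<and> (t1 = 0 \<or> t2 = 0)" if c
  proof -
    obtain \<alpha> \<beta> where "\<alpha> * t1 = 0" "\<beta> * t2 = 0" "\<alpha> \<noteq> 0 \<or> \<beta> \<noteq> 0" "B e e = 0"
      using line_in_polar[OF B p(1,2)] \<open>c\<close> c p(3,4) by blast
    then show ?thesis using c(2) by auto
  qed
  moreover have "s \<in> {-1, 0, 1}" unfolding c by (simp add: sgn_if)
  ultimately show ?thesis using t unfolding k1 valid_profile_def by auto
qed

text \<open>Outside the plane, the normalised e is a third frame vector, independent of the other
  two. Inside it, the orthogonal basis is changed without altering its norms until e points along a
  basis vector.\<close>

lemma adapted_frame_exists:
  assumes B: "sym_form B" "nondegenerate B" and k: "profile B k"
  obtains x where "adapted_frame B k x"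
proof -
  note ba = sym_form_simps[OF B(1)]
  obtain c s t1 t2 where k1: "k = (c, s, t1, t2)" by (metis prod_cases4)
  obtain p1 p2 where p: "adapted B p1 p2" "B p1 p2 = 0" "B p1 p1 = t1" "B p2 p2 = t2"
    using k unfolding profile_def k1 by auto
  have p21: "B p2 p1 = 0" using p(2) sym_form_commute[OF B(1)] by metis
  have c: "c \<longleftrightarrow> e \<in> polar B" "s = sgn (B e e)" using k unfolding profile_def k1 by auto
  have v: "s \<in> {-1,0,1}" "t1 \<in> {-1,0,1}" "t2 \<in> {-1,0,1}"
    using profile_valid[OF B k] unfolding k1 valid_profile_def by auto
  show thesis
  proof (cases c)
    case False
    obtain r where r: "r > 0" "r * (r * B e e) = sgn (B e e)" using normalizing_scalar by blast
    define x where "x i = (if i = 0 then p1 else if i = 1 then p2 else r *\<^sub>R e)" for i :: nat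
    have x: "x 0 = p1" "x 1 = p2" "x (Suc 0) = p2" "x 2 = r *\<^sub>R e" by (auto simp: x_def)
    have ind: "lin_indep_family {0, 1, 2} x"
    proof (rule lin_indep_family_3)
      show "indep2 (x 0) (x 1)" using p(1) unfolding adapted_def x by blast
      show "\<nexists>\<alpha> \<beta>. x 2 = \<alpha> *\<^sub>R x 0 + \<beta> *\<^sub>R x 1"
      proof
        assume "\<exists>\<alpha> \<beta>. x 2 = \<alpha> *\<^sub>R x 0 + \<beta> *\<^sub>R x 1"
        then have "r *\<^sub>R e \<in> polar B" using polar_adapted_iff[OF B p(1)] unfolding x by blast
        then have "e \<in> polar B" using r(1) unfolding polar_def by (simp add: ba)
        then show False using False c by simp
      qed
    qed
    have "B e p1 = 0" "B e p2 = 0" using e_in_Z p(1) unfolding adapted_def by auto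
    moreover from this have "B p1 e = 0" "B p2 e = 0" using sym_form_commute[OF B(1)] by metis+
    ultimately have "orth_family B {0, 1, 2} x (frame_norm s t1 t2)"
      unfolding orth_family_def using ind v p(2-4) p21 r(2) c(2) by (auto simp: frame_norm_def x ba)
    moreover have "\<exists>m. m \<noteq> 0 \<and> e = m *\<^sub>R x 2" using r(1) unfolding x by (intro exI[of _ "1 / r"]) auto
    moreover have "adapted B (x 0) (x 1)" using p(1) by (simp add: x)
    ultimately have "adapted_frame B k x"
      using False unfolding adapted_frame_def k1 frame_index_def line_index_def by simp
    then show thesis using that by blast
  next
    case True
    then have e: "e \<in> polar B" using c by blast
    obtain \<alpha> \<beta> where ab: "e = \<alpha> *\<^sub>R p1 + \<beta> *\<^sub>R p2" "\<alpha> * t1 = 0" "\<beta> * t2 = 0" "\<alpha> \<noteq> 0 \<or> \<beta> \<noteq> 0"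
      using line_in_polar[OF B p(1,2) e] p(3,4) by blast
    \<comment> \<open>If \<open>t1\<close> is nonzero, then \<alpha> = 0 and e is already a multiple
      of \<open>p2\<close>. If \<open>t1 = 0\<close> and \<alpha> is nonzero, e replaces
      \<open>p1\<close>. Otherwise e is a multiple of \<open>p2\<close>, so \<open>t2 = 0\<close>
      too, and e together with \<open>p1\<close> serves.\<close>
    have "\<exists>q1 q2. adapted B q1 q2 \<and> B q1 q2 = 0 \<and> B q1 q1 = t1 \<and> B q2 q2 = t2 \<and> (if t1 = 0 then e = q1 else \<beta> \<noteq> 0 \<and> e = \<beta> *\<^sub>R q2)"
    proof (cases "t1 = 0")
      case False
      then show ?thesis using ab p by (intro exI[of _ p1] exI[of _ p2]) auto
    next
      case t1: True
      show ?thesis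
      proof (cases "\<alpha> = 0")
        case False
        have "adapted B e p2" using adapted_change_basis[OF B(1) p(1), of \<alpha> 1 \<beta> 0] False ab by simp
        moreover have "B e p2 = 0" "B e e = t1" using ab p p21 t1 by (simp_all add: ba)
        ultimately show ?thesis using t1 p by (intro exI[of _ e] exI[of _ p2]) auto
      next
        case True
        then have "\<beta> \<noteq> 0" "t2 = 0" using ab by auto
        then have "adapted B e p1" using adapted_change_basis[OF B(1) p(1), of \<alpha> 0 \<beta> 1] True ab by simp
        moreover have "B e p1 = 0" "B e e = t1" using ab p p21 t1 \<open>t2 = 0\<close> True by (simp_all add: ba)
        ultimately show ?thesis using t1 \<open>t2 = 0\<close> p by (intro exI[of _ e] exI[of _ p1]) auto
      qed
    qed
    then obtain q1 q2 where q: "adapted B q1 q2" "B q1 q2 = 0" "B q1 q1 = t1" "B q2 q2 = t2"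
      and eq: "if t1 = 0 then e = q1 else \<beta> \<noteq> 0 \<and> e = \<beta> *\<^sub>R q2" by blast
    have q21: "B q2 q1 = 0" using q(2) sym_form_commute[OF B(1)] by metis
    define x where "x i = (if i = 0 then q1 else q2)" for i :: nat
    have x: "x 0 = q1" "x 1 = q2" "x (Suc 0) = q2" by (auto simp: x_def)
    have "lin_indep_family {0, 1} x" unfolding lin_indep_family_2 using q(1) unfolding adapted_def x by blast
    then have "orth_family B {0, 1} x (frame_norm s t1 t2)"
      unfolding orth_family_def using v q(2-4) q21 by (auto simp: frame_norm_def x)
    moreover have "\<exists>m. m \<noteq> 0 \<and> e = m *\<^sub>R x (line_index c t1)"
    proof (cases "t1 = 0")
      case True
      then show ?thesis using eq \<open>c\<close> by (intro exI[of _ 1]) (auto simp: line_index_def x)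
    next
      case False
      then show ?thesis using eq \<open>c\<close> by (intro exI[of _ \<beta>]) (auto simp: line_index_def x)
    qed
    ultimately have "adapted_frame B k x"
      using True q(1) unfolding adapted_frame_def k1 frame_index_def by (auto simp: x)
    then show thesis using that by blast
  qed
qed

lemma profile_fits_signature:
  assumes B: "has_signature p q B" and k: "profile B k"
  shows "fits_signature p q k"
proof -
  obtain c s t1 t2 where k1: "k = (c, s, t1, t2)" by (metis prod_cases4)
  have B': "sym_form B" "nondegenerate B" using B unfolding has_signature_def by auto
  obtain x where "adapted_frame B k x" using adapted_frame_exists[OF B' k] by blast
  then have "orth_family B (frame_index c) x (frame_norm s t1 t2)" unfolding adapted_frame_def k1 by auto
  from orth_family_card_le[OF B finite_frame_index this] show ?thesis unfolding k1 fits_signature_def by simp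
qed

lemma adapted_frame_imp_profile:
  assumes B: "sym_form B" "nondegenerate B" and k: "valid_profile k" and x: "adapted_frame B k x"
  shows "profile B k"
proof -
  note ba = sym_form_simps[OF B(1)]
  obtain c s t1 t2 where k1: "k = (c, s, t1, t2)" by (metis prod_cases4)
  have v: "{s, t1, t2} \<subseteq> {-1, 0, 1}" "t2 \<le> t1" "c \<longrightarrow> s = 0 \<and> (t1 = 0 \<or> t2 = 0)"
    using k unfolding k1 valid_profile_def by auto
  have orth: "orth_family B (frame_index c) x (frame_norm s t1 t2)" and ad: "adapted B (x 0) (x 1)"
    using x unfolding adapted_frame_def k1 by auto
  obtain l where l: "l \<noteq> 0" "e = l *\<^sub>R x (line_index c t1)" using x unfolding adapted_frame_def k1 by auto
  have mem: "0 \<in> frame_index c" "1 \<in> frame_index c" "line_index c t1 \<in> frame_index c"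
    unfolding frame_index_def line_index_def by auto
  have xx: "B (x i) (x j) = (if i = j then frame_norm s t1 t2 i else 0)" if "i \<in> frame_index c" "j \<in> frame_index c" for i j
    using orth that unfolding orth_family_def by blast
  have "B (x (line_index c t1)) (x (line_index c t1)) = s"
  proof -
    have "frame_norm s t1 t2 (line_index c t1) = s" using v(3) by (auto simp: line_index_def frame_norm_def)
    then show ?thesis using xx[OF mem(3) mem(3)] by simp
  qed
  then have "B e e = l * (l * s)" unfolding l(2) by (simp add: ba)
  then have "sgn (B e e) = s" using l(1) v(1) by (auto simp: sgn_mult sgn_if)
  moreover have "c \<longleftrightarrow> e \<in> polar B"
  proof (cases c)
    case True
    then have "line_index c t1 = 0 \<or> line_index c t1 = 1" unfolding line_index_def by auto
    then have "e \<in> polar B" using ad unfolding l(2) adapted_def polar_def by (auto simp: ba)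
    then show ?thesis using True by simp
  next
    case False
    have "e \<notin> polar B"
    proof
      assume "e \<in> polar B"
      then obtain \<alpha> \<beta> where "l *\<^sub>R x 2 = \<alpha> *\<^sub>R x 0 + \<beta> *\<^sub>R x 1"
        using polar_adapted_iff[OF B ad] False l(2) unfolding line_index_def by auto
      then have "(\<Sum>i\<in>{0,1,2::nat}. (if i = 0 then \<alpha> else if i = 1 then \<beta> else - l) *\<^sub>R x i) = 0" by simp
      moreover have "lin_indep_family {0,1,2} x" using orth False unfolding orth_family_def frame_index_def by simp
      ultimately have "\<forall>i\<in>{0,1,2::nat}. (if i = 0 then \<alpha> else if i = 1 then \<beta> else - l) = 0"
        unfolding lin_indep_family_def by (elim allE impE)
      then show False using l(1) by auto
    qed
    then show ?thesis using False by simp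
  qed
  moreover have "B (x 0) (x 1) = 0" "B (x 0) (x 0) = t1" "B (x 1) (x 1) = t2"
    using xx mem by (auto simp: frame_norm_def)
  ultimately show ?thesis unfolding k1 profile_def using ad v by blast
qed

text \<open>The factor m on the line is not tied to the determinant on the quotient by Z. The
  relation that automorphisms satisfy is restored later by rescaling.\<close>

definition flag_map :: "('a \<Rightarrow> 'a) \<Rightarrow> bool" where
  "flag_map A \<longleftrightarrow> linear A \<and> bij A \<and> (\<forall>z. A z \<in> Z \<longleftrightarrow> z \<in> Z) \<and> (\<exists>m. m \<noteq> 0 \<and> A e = m *\<^sub>R e)"

text \<open>Equal profiles give adapted frames with equal norms, and Witt's theorem matches them. Z
  is preserved as the polar of the first two frame vectors, and the line because e is a multiple of
  the frame vector with the same index on both sides.\<close>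

lemma flag_isometry_exists:
  assumes B1: "has_signature p q B1" and B2: "has_signature p q B2" and k: "profile B1 k" "profile B2 k"
  obtains A where "flag_map A" "\<And>u v. B2 (A u) (A v) = B1 u v"
proof -
  obtain c s t1 t2 where k1: "k = (c, s, t1, t2)" by (metis prod_cases4)
  have B: "sym_form B1" "nondegenerate B1" "sym_form B2" "nondegenerate B2"
    using B1 B2 unfolding has_signature_def by auto
  obtain x where x: "adapted_frame B1 k x" using adapted_frame_exists[OF B(1,2) k(1)] by blast
  obtain y where y: "adapted_frame B2 k y" using adapted_frame_exists[OF B(3,4) k(2)] by blast
  have "orth_family B1 (frame_index c) x (frame_norm s t1 t2)" "orth_family B2 (frame_index c) y (frame_norm s t1 t2)"
    using x y unfolding adapted_frame_def k1 by auto
  then obtain A where A: "linear A" "\<And>u v. B2 (A u) (A v) = B1 u v" "\<And>i. i \<in> frame_index c \<Longrightarrow> A (x i) = y i"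
    using witt_extension[OF B1 B2 finite_frame_index] by blast
  have mem: "0 \<in> frame_index c" "1 \<in> frame_index c" "line_index c t1 \<in> frame_index c"
    unfolding frame_index_def line_index_def by auto
  have "A z \<in> Z \<longleftrightarrow> z \<in> Z" for z
  proof -
    have "Z = {z. B1 z (x 0) = 0 \<and> B1 z (x 1) = 0}" "Z = {z. B2 z (y 0) = 0 \<and> B2 z (y 1) = 0}"
      using x y unfolding adapted_frame_def k1 adapted_def by auto
    then show ?thesis using A(2)[of z "x 0"] A(2)[of z "x 1"] A(3)[OF mem(1)] A(3)[OF mem(2)]
      by (metis (mono_tags, lifting) mem_Collect_eq)
  qed
  moreover have "\<exists>m. m \<noteq> 0 \<and> A e = m *\<^sub>R e"
  proof -
    have "\<exists>m. m \<noteq> 0 \<and> e = m *\<^sub>R x (line_index c t1)" "\<exists>m. m \<noteq> 0 \<and> e = m *\<^sub>R y (line_index c t1)"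
      using x y unfolding adapted_frame_def k1 by simp_all
    then obtain l m where lm: "l \<noteq> 0" "e = l *\<^sub>R x (line_index c t1)" "m \<noteq> 0" "e = m *\<^sub>R y (line_index c t1)"
      by blast
    have "A e = l *\<^sub>R y (line_index c t1)" by (subst lm(2)) (simp add: linear_scale[OF A(1)] A(3)[OF mem(3)])
    also have "\<dots> = (l / m) *\<^sub>R e" using lm(3) by (subst lm(4)) simp
    finally show ?thesis using lm by (intro exI[of _ "l / m"]) auto
  qed
  ultimately have "flag_map A" unfolding flag_map_def using A(1) isometry_bij[OF A(1) B(3,2) A(2)] by blast
  then show thesis using that A(2) by blast
qed

text \<open>Multiplying the transported basis by the square root of r absorbs the scaling factor, so
  the norms of the basis are unchanged. The norm of e changes only by a positive factor, which its
  sign ignores.\<close>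

lemma profile_flag_map:
  assumes B1: "sym_form B1" "nondegenerate B1" and B2: "sym_form B2" "nondegenerate B2"
    and A: "flag_map A" and r: "r > 0" "\<And>u v. B1 u v = r * B2 (A u) (A v)" and k: "profile B1 k"
  shows "profile B2 k"
proof -
  note ba = sym_form_simps[OF B2(1)]
  obtain c s t1 t2 where k1: "k = (c, s, t1, t2)" by (metis prod_cases4)
  obtain p1 p2 where p: "adapted B1 p1 p2" "B1 p1 p2 = 0" "B1 p1 p1 = t1" "B1 p2 p2 = t2"
    using k unfolding profile_def k1 by auto
  have lin: "linear A" and bij: "bij A" and AZ: "\<And>z. A z \<in> Z \<longleftrightarrow> z \<in> Z" using A unfolding flag_map_def by auto
  obtain l where l: "l \<noteq> 0" "A e = l *\<^sub>R e" using A unfolding flag_map_def by blast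
  define h where "h = sqrt r"
  have h: "h > 0" "h * h = r" using r(1) unfolding h_def by auto
  let ?q1 = "h *\<^sub>R A p1" and ?q2 = "h *\<^sub>R A p2"
  have "indep2 ?q1 ?q2"
    unfolding indep2_def
  proof (intro allI impI)
    fix u v assume "u *\<^sub>R ?q1 + v *\<^sub>R ?q2 = 0"
    then have "A ((u * h) *\<^sub>R p1 + (v * h) *\<^sub>R p2) = A 0"
      by (simp add: linear_add[OF lin] linear_scale[OF lin] linear_0[OF lin])
    then have "(u * h) *\<^sub>R p1 + (v * h) *\<^sub>R p2 = 0" using bij by (metis bij_pointE)
    then have "u * h = 0 \<and> v * h = 0" using p(1) unfolding adapted_def indep2_def by blast
    then show "u = 0 \<and> v = 0" using h by simp
  qed
  moreover have "z \<in> Z \<longleftrightarrow> B2 z ?q1 = 0 \<and> B2 z ?q2 = 0" for z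
  proof -
    obtain w where w: "z = A w" using bij by (metis bij_pointE)
    have "w \<in> Z \<longleftrightarrow> B1 w p1 = 0 \<and> B1 w p2 = 0" using p(1) unfolding adapted_def by blast
    then show ?thesis unfolding w AZ using r h by (simp add: ba)
  qed
  ultimately have ad: "adapted B2 ?q1 ?q2" unfolding adapted_def by blast
  have q: "B2 ?q1 ?q2 = 0" "B2 ?q1 ?q1 = t1" "B2 ?q2 ?q2 = t2"
    using p(2-4) r(2) h(2) by (simp_all add: ba mult.assoc[symmetric])
  have "B1 e e = r * (l * (l * B2 e e))" using r(2)[of e e] by (simp add: l ba)
  then have "sgn (B1 e e) = sgn r * (sgn l * sgn l) * sgn (B2 e e)" by (simp only: sgn_mult mult.assoc)
  moreover have "sgn r = 1" "sgn l * sgn l = 1" using r(1) l(1) by (auto simp: sgn_if)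
  ultimately have s: "sgn (B1 e e) = sgn (B2 e e)" by simp
  have "e \<in> polar B1 \<longleftrightarrow> e \<in> polar B2"
  proof -
    have "e \<in> polar B1 \<longleftrightarrow> (\<forall>z. z \<in> Z \<longrightarrow> B2 (A z) e = 0)"
      unfolding polar_def using r l by (auto simp: ba)
    also have "\<dots> \<longleftrightarrow> (\<forall>z. A z \<in> Z \<longrightarrow> B2 (A z) e = 0)" using AZ by simp
    also have "\<dots> \<longleftrightarrow> e \<in> polar B2" 
    proof -
      have "(\<forall>z. A z \<in> Z \<longrightarrow> B2 (A z) e = 0) \<longleftrightarrow> (\<forall>z\<in>range A. z \<in> Z \<longrightarrow> B2 z e = 0)" by blast
      then show ?thesis unfolding polar_def bij_is_surj[OF bij] by blast
    qed
    finally show ?thesis .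
  qed
  then show ?thesis using k ad q s unfolding k1 profile_def by auto
qed

text \<open>A model form has a frame of the required norms somewhere, whereas the flag is
  prescribed. An orthogonal map A moves a, b and e to the Euclidean normals of the polar of the
  model plane and to the model line; pulling the model form back along A puts it in
  position.\<close>

lemma profile_realizable:
  assumes pq: "p + q = DIM('a)" and k: "valid_profile k" "fits_signature p q k"
  obtains B where "has_signature p q B" "profile B k"
proof -
  obtain c s t1 t2 where k1: "k = (c, s, t1, t2)" by (metis prod_cases4)
  have v: "{s, t1, t2} \<subseteq> {-1, 0, 1}" "t2 \<le> t1" "c \<longrightarrow> s = 0 \<and> (t1 = 0 \<or> t2 = 0)"
    using k unfolding k1 valid_profile_def by auto
  obtain B0 :: "'a \<Rightarrow> 'a \<Rightarrow> real" and x where B0: "has_signature p q B0"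
    and x: "orth_family B0 (frame_index c) x (frame_norm s t1 t2)"
  proof -
    have "frame_norm s t1 t2 i \<in> {-1, 0, 1}" for i using v(1) unfolding frame_norm_def by auto
    then show thesis
      using model_form_orth_family_exists[OF pq finite_frame_index[of c], of "frame_norm s t1 t2"] k(2) that
      unfolding k1 fits_signature_def by auto
  qed
  have B0': "sym_form B0" "nondegenerate B0" using B0 unfolding has_signature_def by auto
  have mem: "0 \<in> frame_index c" "1 \<in> frame_index c" "line_index c t1 \<in> frame_index c"
    unfolding frame_index_def line_index_def by auto
  have xx: "B0 (x i) (x j) = (if i = j then frame_norm s t1 t2 i else 0)" if "i \<in> frame_index c" "j \<in> frame_index c" for i j
    using x that unfolding orth_family_def by blast
  define y where "y = x (line_index c t1)"
  \<comment> \<open>The future line must lie in the future Z. The vector y is either a third frame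
    vector or a null vector of the plane, and both are orthogonal to the plane.\<close>
  have "B0 y (x 0) = 0" "B0 y (x 1) = 0"
  proof -
    have "line_index c t1 = 0 \<Longrightarrow> frame_norm s t1 t2 0 = 0" "line_index c t1 = 1 \<Longrightarrow> frame_norm s t1 t2 1 = 0"
      using v(3) by (auto simp: line_index_def frame_norm_def split: if_splits)
    then show "B0 y (x 0) = 0" "B0 y (x 1) = 0" using xx[OF mem(3,1)] xx[OF mem(3,2)] unfolding y_def by auto
  qed
  then have yq: "y \<bullet> form_op B0 (x 0) = 0" "y \<bullet> form_op B0 (x 1) = 0" by (simp_all add: inner_form_op[OF B0'(1)])
  have ind: "lin_indep_family (frame_index c) x" using x unfolding orth_family_def by blast
  have ind2: "indep2 (x 0) (x 1)"
    unfolding indep2_def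
  proof (intro allI impI)
    fix \<alpha> \<beta> assume *: "\<alpha> *\<^sub>R x 0 + \<beta> *\<^sub>R x 1 = 0"
    have "(\<Sum>i\<in>frame_index c. (if i = 0 then \<alpha> else if i = 1 then \<beta> else 0) *\<^sub>R x i) = 0"
      using * unfolding frame_index_def by simp
    from ind[unfolded lin_indep_family_def, rule_format, OF this] show "\<alpha> = 0 \<and> \<beta> = 0"
      using mem(1,2) by (metis zero_neq_one)
  qed
  have "y \<noteq> 0"
  proof
    assume "y = 0"
    then have "(\<Sum>i\<in>frame_index c. (if i = line_index c t1 then 1 else 0) *\<^sub>R x i) = 0"
      unfolding y_def by (intro sum.neutral) auto
    from ind[unfolded lin_indep_family_def, rule_format, OF this mem(3)] show False by simp
  qed
  have "indep2 (form_op B0 (x 0)) (form_op B0 (x 1))"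
    unfolding indep2_def
  proof (intro allI impI)
    fix \<alpha> \<beta> assume *: "\<alpha> *\<^sub>R form_op B0 (x 0) + \<beta> *\<^sub>R form_op B0 (x 1) = 0"
    have "B0 z (\<alpha> *\<^sub>R x 0 + \<beta> *\<^sub>R x 1) = B0 z 0" for z
    proof -
      have "B0 z (\<alpha> *\<^sub>R x 0 + \<beta> *\<^sub>R x 1) = z \<bullet> (\<alpha> *\<^sub>R form_op B0 (x 0) + \<beta> *\<^sub>R form_op B0 (x 1))"
        by (simp add: sym_form_simps[OF B0'(1)] inner_add_right inner_form_op[OF B0'(1)])
      then show ?thesis unfolding * by (simp add: sym_form_simps[OF B0'(1)])
    qed
    then have "\<alpha> *\<^sub>R x 0 + \<beta> *\<^sub>R x 1 = 0" using form_op_inj[OF B0'] by blast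
    then show "\<alpha> = 0 \<and> \<beta> = 0" using ind2 unfolding indep2_def by blast
  qed
  \<comment> \<open>Orthonormal vectors with the same Euclidean complement, so that they can be the
    images of a and b.\<close>
  then obtain u w where uw: "u \<bullet> u = 1" "w \<bullet> w = 1" "u \<bullet> w = 0"
    "\<And>z. z \<bullet> form_op B0 (x 0) = 0 \<and> z \<bullet> form_op B0 (x 1) = 0 \<longleftrightarrow> z \<bullet> u = 0 \<and> z \<bullet> w = 0"
    using gram_schmidt_2 by blast
  define y' where "y' = (1 / norm y) *\<^sub>R y"
  have "y \<bullet> u = 0" "y \<bullet> w = 0" using yq uw(4) by blast+
  then have y': "y' \<bullet> y' = 1" "u \<bullet> y' = 0" "w \<bullet> y' = 0"
    using \<open>y \<noteq> 0\<close> unfolding y'_def by (auto simp: dot_square_norm power2_eq_square inner_commute)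
  obtain m n where mn: "has_signature m n ((\<bullet>) :: 'a \<Rightarrow> 'a \<Rightarrow> real)" using has_signature_inner by blast
  let ?f = "\<lambda>i::nat. if i = 0 then a else if i = 1 then b else e" and ?g = "\<lambda>i::nat. if i = 0 then u else if i = 1 then w else y'"
  have "orth_family (\<bullet>) {0, 1, 2} ?f (\<lambda>_. 1)" "orth_family (\<bullet>) {0, 1, 2} ?g (\<lambda>_. 1)"
    using orthonormal uw y' by (intro orthonormal_triple_orth_family; simp add: inner_commute)+
  then obtain A where A: "linear A" "\<And>u v. A u \<bullet> A v = u \<bullet> v" and A': "\<And>i. i \<in> {0, 1, 2} \<Longrightarrow> A (?f i) = ?g i"
    using witt_extension[OF mn mn, of "{0, 1, 2}" ?f "\<lambda>_. 1" ?g] by (metis (no_types, lifting) finite.emptyI finite.insertI)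
  have Aabe: "A a = u" "A b = w" "A e = y'" using A'[of 0] A'[of 1] A'[of 2] by auto
  have bij: "bij A" using isometry_bij[OF A(1), of "(\<bullet>)" "(\<bullet>)"] mn A(2) unfolding has_signature_def by blast
  define B where "B \<equiv> \<lambda>u v. B0 (A u) (A v)"
  have sig: "has_signature p q B" unfolding B_def using has_signature_pullback[OF B0 A(1) bij] .
  define f where "f i = inv A (x i)" for i
  have Af: "A (f i) = x i" for i unfolding f_def using bij by (simp add: bij_is_surj surj_f_inv_f)
  have lin_f: "lin_indep_family (frame_index c) f"
    unfolding lin_indep_family_def
  proof (intro allI impI)
    fix d assume "(\<Sum>i\<in>frame_index c. d i *\<^sub>R f i) = 0"
    then have "A (\<Sum>i\<in>frame_index c. d i *\<^sub>R f i) = 0" using linear_0[OF A(1)] by simp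
    then have "(\<Sum>i\<in>frame_index c. d i *\<^sub>R x i) = 0" by (simp add: linear_sum[OF A(1)] linear_scale[OF A(1)] Af)
    then show "\<forall>i\<in>frame_index c. d i = 0" using ind unfolding lin_indep_family_def by blast
  qed
  have orth: "orth_family B (frame_index c) f (frame_norm s t1 t2)"
    using x lin_f unfolding orth_family_def B_def Af by blast
  have "indep2 (f 0) (f 1)"
    unfolding indep2_def
  proof (intro allI impI)
    fix \<alpha> \<beta> assume "\<alpha> *\<^sub>R f 0 + \<beta> *\<^sub>R f 1 = 0"
    then have "A (\<alpha> *\<^sub>R f 0 + \<beta> *\<^sub>R f 1) = 0" using linear_0[OF A(1)] by simp
    then have "\<alpha> *\<^sub>R x 0 + \<beta> *\<^sub>R x 1 = 0" by (simp add: linear_add[OF A(1)] linear_scale[OF A(1)] Af)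
    then show "\<alpha> = 0 \<and> \<beta> = 0" using ind2 unfolding indep2_def by blast
  qed
  moreover have "z \<in> Z \<longleftrightarrow> B z (f 0) = 0 \<and> B z (f 1) = 0" for z
  proof -
    have "z \<in> Z \<longleftrightarrow> A z \<bullet> u = 0 \<and> A z \<bullet> w = 0" unfolding Z_def using A(2)[of z a] A(2)[of z b] Aabe by simp
    then show ?thesis using uw(4)[of "A z"] unfolding B_def Af by (simp add: inner_form_op[OF B0'(1)])
  qed
  ultimately have "adapted B (f 0) (f 1)" unfolding adapted_def by blast
  moreover have "e = (1 / norm y) *\<^sub>R f (line_index c t1)"
  proof -
    have "A e = A ((1 / norm y) *\<^sub>R f (line_index c t1))"
      by (simp add: linear_scale[OF A(1)] Af Aabe y'_def y_def)
    then show ?thesis using bij by (metis bij_pointE)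
  qed
  ultimately have "adapted_frame B k f"
    using orth \<open>y \<noteq> 0\<close> unfolding adapted_frame_def k1 by (auto intro!: exI[of _ "1 / norm y"])
  then have "profile B k"
    using adapted_frame_imp_profile[OF _ _ k(1)] sig unfolding has_signature_def by blast
  with sig show thesis using that by blast
qed

end

section \<open>Left-invariant metrics\<close>

type_synonym 'k heis_space = "(real \<times> real \<times> real) \<times> (real ^ 'k)"

definition hx :: "'k::finite heis_space \<Rightarrow> real" where "hx u = fst (fst u)"
definition hy :: "'k::finite heis_space \<Rightarrow> real" where "hy u = fst (snd (fst u))"
definition e_x :: "'k::finite heis_space" where "e_x = ((1, 0, 0), 0)"
definition e_y :: "'k::finite heis_space" where "e_y = ((0, 1, 0), 0)"
definition e_z :: "'k::finite heis_space" where "e_z = ((0, 0, 1), 0)"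

interpretation heis: flag "e_z :: 'k::finite heis_space" e_x e_y
  by unfold_locales (auto simp: e_x_def e_y_def e_z_def inner_prod_def)

lemma hx_simps [simp]:
  "hx (u + v) = hx u + hx v" "hx (u - v) = hx u - hx v" "hx (c *\<^sub>R u) = c * hx u" "hx (- u) = - hx u" "hx 0 = 0"
  "hx e_x = 1" "hx e_y = 0" "hx e_z = 0"
  and hy_simps [simp]:
  "hy (u + v) = hy u + hy v" "hy (u - v) = hy u - hy v" "hy (c *\<^sub>R u) = c * hy u" "hy (- u) = - hy u" "hy 0 = 0"
  "hy e_x = 0" "hy e_y = 1" "hy e_z = 0"
  by (auto simp: hx_def hy_def e_x_def e_y_def e_z_def)

lemma hx_inner: "hx u = u \<bullet> e_x" and hy_inner: "hy u = u \<bullet> e_y"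
  by (auto simp: hx_def hy_def e_x_def e_y_def inner_prod_def)

lemma heis_Z: "z \<in> heis.Z \<longleftrightarrow> hx z = 0 \<and> hy z = 0"
  unfolding heis.Z_def hx_inner hy_inner by simp

text \<open>The product is vector addition plus a bilinear central term, so later computations need
  only the two functionals \<open>hx\<close> and \<open>hy\<close>, not coordinates.\<close>

lemma G_mult_eq: "G_mult a u = a + u + (hx a * hy u) *\<^sub>R e_z"
proof -
  obtain x y z w x' y' z' w' where "a = ((x, y, z), w)" "u = ((x', y', z'), w')" by (metis prod.collapse)
  then show ?thesis by (simp add: G_mult_def hx_def hy_def e_z_def)
qed

text \<open>The differential of left translation by a. It is the same at every point because the
  product is affine in its second argument.\<close>

definition left_trans :: "'k::finite heis_space \<Rightarrow> 'k heis_space \<Rightarrow> 'k heis_space" where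
  "left_trans a u = u + (hx a * hy u) *\<^sub>R e_z"

lemma linear_left_trans: "linear (left_trans a)"
  unfolding linear_iff left_trans_def by (simp add: algebra_simps)

lemma left_trans_simps [simp]:
  "hx (left_trans a u) = hx u" "hy (left_trans a u) = hy u" "left_trans 0 u = u"
  "left_trans a (left_trans (- a) u) = u" "left_trans (- a) (left_trans a u) = u"
  by (simp_all add: left_trans_def)

lemma left_trans_G_mult: "left_trans (G_mult a b) u = left_trans a (left_trans b u)"
  by (simp add: left_trans_def G_mult_eq algebra_simps)

lemma bij_left_trans: "bij (left_trans a)"
  by (rule o_bij[of "left_trans (- a)"]) (auto simp: fun_eq_iff)

lemma G_mult_has_derivative: "(G_mult b has_derivative left_trans b) (at a)"
proof -
  have "(left_trans b has_derivative left_trans b) (at a)"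
    using linear_left_trans linear_conv_bounded_linear bounded_linear_imp_has_derivative by blast
  then have "((\<lambda>u. b + left_trans b u) has_derivative left_trans b) (at a)"
    by (auto intro!: derivative_eq_intros)
  moreover have "G_mult b = (\<lambda>u. b + left_trans b u)" by (simp add: fun_eq_iff G_mult_eq left_trans_def algebra_simps)
  ultimately show ?thesis by simp
qed

lemma frechet_derivative_G_mult: "frechet_derivative (G_mult b) (at a) = left_trans b"
  by (rule frechet_derivative_at[OF G_mult_has_derivative, symmetric])

lemma G_mult_0: "G_mult a 0 = a"
  by (simp add: G_mult_eq)

text \<open>Invariance under translation from the identity to a determines the form at a.
  Translations compose as the group does, which gives invariance everywhere, and their differentials
  are bijective, which carries the signature along.\<close>

lemma left_inv_metric_iff:
  "left_inv_metric p q g \<longleftrightarrow>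
     has_signature p q (g 0) \<and> (\<forall>a x y. g a (left_trans a x) (left_trans a y) = g 0 x y)"
proof
  assume g: "left_inv_metric p q g"
  then have "g (G_mult a 0) (left_trans a x) (left_trans a y) = g 0 x y" for a x y
    unfolding left_inv_metric_def frechet_derivative_G_mult by blast
  moreover have "has_signature p q (g 0)" using g unfolding left_inv_metric_def by blast
  ultimately show "has_signature p q (g 0) \<and> (\<forall>a x y. g a (left_trans a x) (left_trans a y) = g 0 x y)"
    unfolding G_mult_0 by blast
next
  assume *: "has_signature p q (g 0) \<and> (\<forall>a x y. g a (left_trans a x) (left_trans a y) = g 0 x y)"
  have eq: "g a = (\<lambda>x y. g 0 (left_trans (- a) x) (left_trans (- a) y))" for a
  proof (intro ext)
    fix x y
    have "g a (left_trans a (left_trans (- a) x)) (left_trans a (left_trans (- a) y))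
        = g 0 (left_trans (- a) x) (left_trans (- a) y)" using * by blast
    then show "g a x y = g 0 (left_trans (- a) x) (left_trans (- a) y)" by simp
  qed
  have "has_signature p q (g a)" for a
    unfolding eq[of a] using * has_signature_pullback[OF _ linear_left_trans bij_left_trans] by blast
  moreover have "g (G_mult b a) (left_trans b x) (left_trans b y) = g a x y" for a b x y
  proof -
    have "g (G_mult b a) (left_trans (G_mult b a) (left_trans (- a) x)) (left_trans (G_mult b a) (left_trans (- a) y))
        = g 0 (left_trans (- a) x) (left_trans (- a) y)" using * by blast
    then show ?thesis unfolding left_trans_G_mult by (simp add: eq[of a])
  qed
  ultimately show "left_inv_metric p q g" unfolding left_inv_metric_def frechet_derivative_G_mult by blast
qed

lemma left_inv_metric_of_form:
  assumes "has_signature p q B"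
  obtains g where "left_inv_metric p q g" "g 0 = B"
proof
  let ?g = "\<lambda>a x y. B (left_trans (- a) x) (left_trans (- a) y)"
  show "?g 0 = B" by (simp add: fun_eq_iff)
  then show "left_inv_metric p q ?g" using assms unfolding left_inv_metric_iff by simp
qed

text \<open>A class closed under directional derivatives, so membership yields smoothness in the
  sense of iterated partial derivatives. The automorphisms constructed below belong to it.\<close>

definition quadratic_map :: "('a::euclidean_space \<Rightarrow> 'b::euclidean_space) \<Rightarrow> bool" where
  "quadratic_map f \<longleftrightarrow> (\<exists>k L Q. linear L \<and> bilinear Q \<and> f = (\<lambda>x. k + L x + Q x x))"

lemma quadratic_map_has_derivative:
  fixes L :: "'a::euclidean_space \<Rightarrow> 'b::euclidean_space"
  assumes "linear L" "bilinear Q"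
  shows "((\<lambda>x. k + L x + Q x x) has_derivative (\<lambda>v. L v + (Q x v + Q v x))) (at x)"
proof -
  have "bounded_linear L" using assms(1) linear_conv_bounded_linear by blast
  then have "(L has_derivative L) (at x)" by (rule bounded_linear_imp_has_derivative)
  moreover have "bounded_bilinear Q" using assms(2) bilinear_conv_bounded_bilinear by blast
  then have "((\<lambda>x. Q x x) has_derivative (\<lambda>v. Q x v + Q v x)) (at x)"
    using bounded_bilinear.FDERIV[OF _ has_derivative_ident has_derivative_ident] by blast
  ultimately show ?thesis by (auto intro!: derivative_eq_intros)
qed

lemma quadratic_map_pderiv:
  assumes "quadratic_map f"
  shows "quadratic_map (\<lambda>x. frechet_derivative f (at x) v)"
proof -
  obtain k L Q where f: "linear L" "bilinear Q" "f = (\<lambda>x. k + L x + Q x x)"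
    using assms unfolding quadratic_map_def by blast
  have "frechet_derivative f (at x) v = L v + (Q x v + Q v x) + 0" for x
    using frechet_derivative_at[OF quadratic_map_has_derivative[OF f(1,2), of k x]] unfolding f(3)
    by (metis add.right_neutral)
  moreover have "linear (\<lambda>x. Q x v + Q v x)"
    using f(2) unfolding bilinear_def by (auto intro!: linear_compose_add)
  moreover have "bilinear (\<lambda>(x::'a) (y::'a). 0::'b)" unfolding bilinear_def by (simp add: linear_zero)
  ultimately show ?thesis unfolding quadratic_map_def
    by (intro exI[of _ "L v"] exI[of _ "\<lambda>x. Q x v + Q v x"] exI[of _ "\<lambda>x y. 0"]) (auto simp: fun_eq_iff)
qed

lemma quadratic_map_smooth:
  fixes f :: "'a::euclidean_space \<Rightarrow> 'b::euclidean_space"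
  assumes "quadratic_map f"
  shows "smooth_map f"
proof -
  have "quadratic_map (iter_pderiv vs f)" for vs
    using assms by (induction vs) (auto intro: quadratic_map_pderiv)
  moreover have "g differentiable (at x)" if "quadratic_map g" for g :: "'a \<Rightarrow> 'b" and x
    using that quadratic_map_has_derivative unfolding quadratic_map_def differentiable_def by blast
  ultimately show ?thesis unfolding smooth_map_def by blast
qed

text \<open>Differentiating along the line through z passes from what an automorphism preserves to
  what its derivative at the identity preserves.\<close>

lemma derivative_stays_in_hyperplane:
  fixes f :: "'a::euclidean_space \<Rightarrow> 'a"
  assumes f: "(f has_derivative A) (at 0)" and h: "\<And>t. f (t *\<^sub>R z) \<bullet> v = 0"
  shows "A z \<bullet> v = 0"
proof -
  have l: "((\<lambda>t::real. t *\<^sub>R z) has_derivative (\<lambda>t. t *\<^sub>R z)) (at 0)"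
    by (auto intro!: derivative_eq_intros)
  have "(f has_derivative A) (at ((0::real) *\<^sub>R z))" using f by simp
  from has_derivative_compose[OF l this]
  have "((\<lambda>t. f (t *\<^sub>R z) \<bullet> v) has_derivative (\<lambda>t. A (t *\<^sub>R z) \<bullet> v)) (at 0)"
    by (auto intro!: derivative_eq_intros)
  then have "((\<lambda>t::real. 0::real) has_derivative (\<lambda>t. A (t *\<^sub>R z) \<bullet> v)) (at 0)" unfolding h .
  moreover have "((\<lambda>t::real. 0::real) has_derivative (\<lambda>t. 0)) (at 0)" by simp
  ultimately have "(\<lambda>t. A (t *\<^sub>R z) \<bullet> v) = (\<lambda>t. 0)" by (rule has_derivative_unique)
  then have "A (1 *\<^sub>R z) \<bullet> v = 0" by metis
  then show ?thesis by simp
qed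

section \<open>Automorphisms and their derivatives at the identity\<close>

lemma G_auto_zero:
  assumes "G_auto \<phi>"
  shows "\<phi> 0 = 0"
proof -
  have "\<phi> (G_mult 0 0) = G_mult (\<phi> 0) (\<phi> 0)" using assms unfolding G_auto_def by blast
  then have eq: "\<phi> 0 = \<phi> 0 + \<phi> 0 + (hx (\<phi> 0) * hy (\<phi> 0)) *\<^sub>R e_z" unfolding G_mult_0 by (simp add: G_mult_eq)
  from arg_cong[OF this, of hx] have "hx (\<phi> 0) = 0" by simp
  then show ?thesis using eq by simp
qed

lemma heis_Z_iff_central:
  fixes z :: "'k::finite heis_space"
  shows "z \<in> heis.Z \<longleftrightarrow> (\<forall>u. G_mult z u = G_mult u z)"
proof
  assume c: "\<forall>u. G_mult z u = G_mult u z"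
  have ez: "(e_z :: 'k heis_space) \<noteq> 0" by (rule heis.e_nonzero)
  have *: "hx z * hy u = hx u * hy z" for u :: "'k heis_space"
    using c[rule_format, of u] ez by (simp add: G_mult_eq add.commute)
  show "z \<in> heis.Z" using *[of e_x] *[of e_y] unfolding heis_Z by simp
qed (simp add: heis_Z G_mult_eq add.commute)

lemma G_auto_Z:
  assumes "G_auto \<phi>" "z \<in> heis.Z"
  shows "\<phi> z \<in> heis.Z"
  unfolding heis_Z_iff_central
proof
  fix u
  obtain w where u: "u = \<phi> w" using assms(1) unfolding G_auto_def by (metis bij_pointE)
  have hom: "\<And>a b. \<phi> (G_mult a b) = G_mult (\<phi> a) (\<phi> b)" using assms(1) unfolding G_auto_def by blast
  have "G_mult z w = G_mult w z" using assms(2) unfolding heis_Z_iff_central by blast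
  then show "G_mult (\<phi> z) u = G_mult u (\<phi> z)" unfolding u hom[symmetric] by simp
qed

text \<open>\<open>t e_z\<close> is the commutator of \<open>t e_x\<close> and \<open>e_y\<close>.\<close>
lemma G_auto_commutator:
  fixes \<phi> :: "'k::finite heis_space \<Rightarrow> 'k heis_space"
  assumes "G_auto \<phi>"
  obtains c where "\<phi> (t *\<^sub>R e_z) = c *\<^sub>R e_z"
proof -
  let ?a = "t *\<^sub>R e_x :: 'k heis_space" and ?b = "e_y :: 'k heis_space"
  have hom: "\<And>a b. \<phi> (G_mult a b) = G_mult (\<phi> a) (\<phi> b)" using assms unfolding G_auto_def by blast
  have "G_mult ?a ?b = G_mult (G_mult ?b ?a) (t *\<^sub>R e_z)" by (simp add: G_mult_eq add.commute)
  then have "G_mult (\<phi> ?a) (\<phi> ?b) = G_mult (G_mult (\<phi> ?b) (\<phi> ?a)) (\<phi> (t *\<^sub>R e_z))" by (metis hom)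
  then have "\<phi> (t *\<^sub>R e_z) = (hx (\<phi> ?a) * hy (\<phi> ?b) - hx (\<phi> ?b) * hy (\<phi> ?a)
      - (hx (\<phi> ?b) + hx (\<phi> ?a)) * hy (\<phi> (t *\<^sub>R e_z))) *\<^sub>R e_z"
    by (simp add: G_mult_eq algebra_simps)
  then show thesis using that by blast
qed

lemma G_auto_inv:
  assumes "G_auto \<phi>"
  shows "G_auto (inv \<phi>)"
proof -
  have bij: "bij \<phi>" and hom: "\<And>a b. \<phi> (G_mult a b) = G_mult (\<phi> a) (\<phi> b)"
    using assms unfolding G_auto_def by auto
  have "inv \<phi> (G_mult a b) = G_mult (inv \<phi> a) (inv \<phi> b)" for a b
  proof -
    have "\<phi> (G_mult (inv \<phi> a) (inv \<phi> b)) = G_mult a b" using bij hom by (simp add: bij_is_surj surj_f_inv_f)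
    then show ?thesis using bij by (metis bij_inv_eq_iff)
  qed
  then show ?thesis using assms bij unfolding G_auto_def by (simp add: bij_imp_bij_inv inv_inv_eq)
qed

lemma G_auto_has_derivative:
  assumes "G_auto \<phi>"
  shows "(\<phi> has_derivative frechet_derivative \<phi> (at x)) (at x)"
proof -
  have "iter_pderiv [] \<phi> differentiable (at x)" using assms unfolding G_auto_def smooth_map_def by (metis empty_set empty_subsetI)
  then show ?thesis using frechet_derivative_works[of \<phi>] by simp
qed

lemma G_auto_derivative_Z:
  assumes "G_auto \<phi>" "z \<in> heis.Z"
  shows "frechet_derivative \<phi> (at 0) z \<in> heis.Z"
proof -
  have "\<phi> (t *\<^sub>R z) \<in> heis.Z" for t using G_auto_Z[OF assms(1), of "t *\<^sub>R z"] assms(2) unfolding heis_Z by simp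
  then show ?thesis
    using derivative_stays_in_hyperplane[OF G_auto_has_derivative[OF assms(1)]] unfolding heis.Z_def by blast
qed

lemma G_auto_derivative_inverse:
  fixes \<phi> :: "'k::finite heis_space \<Rightarrow> 'k heis_space"
  assumes "G_auto \<phi>"
  shows "frechet_derivative (inv \<phi>) (at 0) (frechet_derivative \<phi> (at 0) u) = u"
proof -
  have "(inv \<phi> has_derivative frechet_derivative (inv \<phi>) (at 0)) (at (\<phi> 0))"
    using G_auto_has_derivative[OF G_auto_inv[OF assms]] G_auto_zero[OF assms] by simp
  from has_derivative_compose[OF G_auto_has_derivative[OF assms] this]
  have "((\<lambda>x. x) has_derivative (\<lambda>u. frechet_derivative (inv \<phi>) (at 0) (frechet_derivative \<phi> (at 0) u))) (at 0)"
    using assms unfolding G_auto_def by (simp add: bij_is_inj)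
  from has_derivative_unique[OF this has_derivative_ident] show ?thesis by metis
qed

lemma G_auto_derivative_flag_map:
  fixes \<phi> :: "'k::finite heis_space \<Rightarrow> 'k heis_space"
  assumes "G_auto \<phi>"
  shows "heis.flag_map (frechet_derivative \<phi> (at 0))"
proof -
  define A where "A = frechet_derivative \<phi> (at 0)"
  define A' where "A' = frechet_derivative (inv \<phi>) (at 0)"
  have inv: "G_auto (inv \<phi>)" "inv (inv \<phi>) = \<phi>" using G_auto_inv[OF assms] assms unfolding G_auto_def
    by (auto simp: inv_inv_eq)
  have d: "(\<phi> has_derivative A) (at 0)" unfolding A_def by (rule G_auto_has_derivative[OF assms])
  have lin: "linear A" using d has_derivative_linear by blast
  have A'A: "A' (A u) = u" "A (A' u) = u" for u
    using G_auto_derivative_inverse[OF assms] G_auto_derivative_inverse[OF inv(1)] unfolding A_def A'_def inv(2) by auto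
  then have bij: "bij A" by (intro o_bij[of A']) (auto simp: fun_eq_iff)
  have "A z \<in> heis.Z \<longleftrightarrow> z \<in> heis.Z" for z
    using G_auto_derivative_Z[OF assms, of z] G_auto_derivative_Z[OF inv(1), of "A z"] A'A
    unfolding A_def[symmetric] A'_def[symmetric] by auto
  moreover have "\<exists>m. m \<noteq> 0 \<and> A e_z = m *\<^sub>R e_z"
  proof -
    define m where "m = A e_z \<bullet> e_z"
    \<comment> \<open>The part of \<open>A e_z\<close> orthogonal to \<open>e_z\<close>. Since
      \<open>\<phi>\<close> keeps the centre line, its values there are orthogonal to v, hence so is
      \<open>A e_z\<close>, and v is orthogonal to itself.\<close>
    define v where "v = A e_z - m *\<^sub>R e_z"
    have ee: "e_z \<bullet> (e_z :: 'k heis_space) = 1" by (rule heis.orthonormal)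
    have ve: "e_z \<bullet> v = 0" unfolding v_def m_def by (simp add: inner_diff_right ee inner_commute)
    have "\<phi> (t *\<^sub>R e_z) \<bullet> v = 0" for t using G_auto_commutator[OF assms, of t] ve by (metis inner_scaleR_left mult_zero_right)
    then have "A e_z \<bullet> v = 0" using derivative_stays_in_hyperplane[OF d] by blast
    then have "v \<bullet> v = 0" by (subst v_def) (simp add: inner_diff_left ve)
    then have "A e_z = m *\<^sub>R e_z" unfolding v_def by simp
    moreover have "m \<noteq> 0"
    proof
      assume "m = 0"
      then have "A e_z = A 0" using calculation linear_0[OF lin] by simp
      then show False using bij heis.e_nonzero by (metis bij_pointE)
    qed
    ultimately show ?thesis by blast
  qed
  ultimately show ?thesis using lin bij unfolding heis.flag_map_def A_def by blast
qed

text \<open>In exponential coordinates an automorphism of the simply connected group is linear; the quadratic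
  term is the change to the coordinates in which the product is \<open>G_mult\<close>.\<close>
definition auto_of_linear :: "real \<Rightarrow> ('k::finite heis_space \<Rightarrow> 'k heis_space) \<Rightarrow> 'k heis_space \<Rightarrow> 'k heis_space" where
  "auto_of_linear m A u = A u + ((hx (A u) * hy (A u) - m * (hx u * hy u)) / 2) *\<^sub>R e_z"

definition auto_bilinear :: "real \<Rightarrow> ('k::finite heis_space \<Rightarrow> 'k heis_space) \<Rightarrow> 'k heis_space \<Rightarrow> 'k heis_space \<Rightarrow> 'k heis_space" where
  "auto_bilinear m A u v = ((hx (A u) * hy (A v) - m * (hx u * hy v)) / 2) *\<^sub>R e_z"

lemma bilinear_auto_bilinear:
  assumes "linear A"
  shows "bilinear (auto_bilinear m A)"
  unfolding bilinear_def linear_iff auto_bilinear_def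
  by (simp add: linear_add[OF assms] linear_scale[OF assms] scaleR_add_left[symmetric] add_divide_distrib[symmetric])
    (simp add: algebra_simps)

lemma auto_of_linear_eq: "auto_of_linear m A = (\<lambda>u. 0 + A u + auto_bilinear m A u u)"
  by (simp add: fun_eq_iff auto_of_linear_def auto_bilinear_def)

lemma auto_of_linear_smooth: "linear A \<Longrightarrow> smooth_map (auto_of_linear m A)"
  unfolding auto_of_linear_eq using bilinear_auto_bilinear
  by (intro quadratic_map_smooth) (unfold quadratic_map_def, blast)

lemma auto_of_linear_inverse:
  fixes A :: "'k::finite heis_space \<Rightarrow> 'k heis_space"
  assumes "linear A" "linear A'" "\<And>u. A' (A u) = u" "A e_z = m *\<^sub>R e_z" "m \<noteq> 0"
  shows "auto_of_linear (1 / m) A' (auto_of_linear m A u) = u"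
proof -
  have "A' e_z = A' ((1 / m) *\<^sub>R A e_z)" using assms(4,5) by simp
  then have e: "A' e_z = (1 / m) *\<^sub>R e_z" by (simp add: linear_scale[OF assms(2)] assms(3))
  define c where "c = (hx (A u) * hy (A u) - m * (hx u * hy u)) / 2"
  have "A' (auto_of_linear m A u) = u + (c / m) *\<^sub>R e_z"
    unfolding auto_of_linear_def c_def[symmetric]
    by (simp add: linear_add[OF assms(2)] linear_scale[OF assms(2)] assms(3) e)
  moreover have "hx (auto_of_linear m A u) = hx (A u)" "hy (auto_of_linear m A u) = hy (A u)"
    unfolding auto_of_linear_def by simp_all
  ultimately have "auto_of_linear (1 / m) A' (auto_of_linear m A u)
      = u + (c / m + (hx u * hy u - (1 / m) * (hx (A u) * hy (A u))) / 2) *\<^sub>R e_z"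
    by (subst auto_of_linear_def) (simp add: scaleR_add_left add.assoc)
  moreover have "c / m + (hx u * hy u - (1 / m) * (hx (A u) * hy (A u))) / 2 = 0"
    unfolding c_def using assms(5) by (simp add: field_simps)
  ultimately show ?thesis by simp
qed

text \<open>The assumption \<open>det\<close> says that A respects the bracket, the antisymmetric
  part of the central term. The symmetric part is the coboundary of half of hx * hy, and the
  quadratic correction in \<open>auto_of_linear\<close> accounts for it.\<close>

lemma auto_of_linear_hom:
  assumes "linear A" "A e_z = m *\<^sub>R e_z"
    and det: "\<And>u v. hx (A u) * hy (A v) - hx (A v) * hy (A u) = m * (hx u * hy v - hx v * hy u)"
  shows "auto_of_linear m A (G_mult u v) = G_mult (auto_of_linear m A u) (auto_of_linear m A v)"
proof -
  define q where "q u = (hx (A u) * hy (A u) - m * (hx u * hy u)) / 2" for u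
  have phi: "auto_of_linear m A u = A u + q u *\<^sub>R e_z" for u unfolding q_def auto_of_linear_def by simp
  have A: "A (G_mult u v) = A u + A v + (hx u * hy v * m) *\<^sub>R e_z"
    by (simp add: G_mult_eq linear_add[OF assms(1)] linear_scale[OF assms(1)] assms(2))
  have "hx u * hy v * m + q (G_mult u v) = q u + q v + hx (A u) * hy (A v)"
    using det[of u v] unfolding q_def A by (simp add: G_mult_eq field_simps)
  then have "A u + A v + (hx u * hy v * m + q (G_mult u v)) *\<^sub>R e_z = A u + A v + (q u + q v + hx (A u) * hy (A v)) *\<^sub>R e_z"
    by simp
  then show ?thesis unfolding phi A by (simp add: G_mult_eq scaleR_add_left algebra_simps)
qed

lemma auto_of_linear_G_auto:
  fixes A :: "'k::finite heis_space \<Rightarrow> 'k heis_space"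
  assumes A: "linear A" "bij A" "A e_z = m *\<^sub>R e_z" "m \<noteq> 0"
    and det: "\<And>u v. hx (A u) * hy (A v) - hx (A v) * hy (A u) = m * (hx u * hy v - hx v * hy u)"
  shows "G_auto (auto_of_linear m A)"
proof -
  have inv: "inv A (A u) = u" "A (inv A u) = u" for u
    using A(2) by (simp_all add: bij_is_inj bij_is_surj surj_f_inv_f)
  have lin: "linear (inv A)" using A(1,2) by (simp add: bij_is_inj inj_linear_imp_inv_linear)
  have e: "inv A e_z = (1 / m) *\<^sub>R e_z"
  proof -
    have "inv A e_z = inv A (A ((1 / m) *\<^sub>R e_z))" using A(3,4) by (simp add: linear_scale[OF A(1)])
    then show ?thesis by (simp add: inv)
  qed
  let ?f = "auto_of_linear m A" and ?g = "auto_of_linear (1 / m) (inv A)"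
  have gf: "?g (?f u) = u" for u using auto_of_linear_inverse[OF A(1) lin inv(1) A(3,4)] .
  have fg: "?f (?g u) = u" for u using auto_of_linear_inverse[OF lin A(1) inv(2) e] A(4) by simp
  have "bij ?f" by (rule o_bij[of ?g]) (auto simp: fun_eq_iff gf fg)
  moreover have "inv ?f = ?g" using gf fg by (intro inv_unique_comp) (auto simp: fun_eq_iff)
  ultimately show ?thesis
    unfolding G_auto_def using auto_of_linear_smooth[OF A(1)] auto_of_linear_smooth[OF lin] auto_of_linear_hom[OF A(1,3) det] by auto
qed

lemma auto_of_linear_derivative_0:
  assumes "linear A"
  shows "frechet_derivative (auto_of_linear m A) (at 0) = A"
proof -
  have "(auto_of_linear m A has_derivative (\<lambda>v. A v + (auto_bilinear m A 0 v + auto_bilinear m A v 0))) (at 0)"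
    unfolding auto_of_linear_eq using quadratic_map_has_derivative[OF assms bilinear_auto_bilinear[OF assms]] .
  moreover have "auto_bilinear m A 0 v = 0" "auto_bilinear m A v 0 = 0" for v
    unfolding auto_bilinear_def by (simp_all add: linear_0[OF assms])
  ultimately have "(auto_of_linear m A has_derivative A) (at 0)" by simp
  then show ?thesis by (rule frechet_derivative_at[symmetric])
qed

text \<open>The derivative at the identity of the homomorphism law with a held fixed. It reduces an
  equivalence of left-invariant metrics to an equation between forms at the identity.\<close>

lemma G_auto_derivative_left_trans:
  assumes "G_auto \<phi>"
  shows "frechet_derivative \<phi> (at a) (left_trans a x) = left_trans (\<phi> a) (frechet_derivative \<phi> (at 0) x)"
proof -
  have hom: "(\<lambda>u. \<phi> (G_mult a u)) = (\<lambda>u. G_mult (\<phi> a) (\<phi> u))" using assms unfolding G_auto_def by presburger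
  have "(\<phi> has_derivative frechet_derivative \<phi> (at a)) (at (G_mult a 0))"
    using G_auto_has_derivative[OF assms] by (simp add: G_mult_0)
  from has_derivative_compose[OF G_mult_has_derivative this]
  have "((\<lambda>u. \<phi> (G_mult a u)) has_derivative (\<lambda>x. frechet_derivative \<phi> (at a) (left_trans a x))) (at 0)" .
  moreover from has_derivative_compose[OF G_auto_has_derivative[OF assms] G_mult_has_derivative]
  have "((\<lambda>u. \<phi> (G_mult a u)) has_derivative (\<lambda>x. left_trans (\<phi> a) (frechet_derivative \<phi> (at 0) x))) (at 0)"
    unfolding hom .
  ultimately have "(\<lambda>x. frechet_derivative \<phi> (at a) (left_trans a x)) = (\<lambda>x. left_trans (\<phi> a) (frechet_derivative \<phi> (at 0) x))"
    by (rule has_derivative_unique)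
  then show ?thesis by metis
qed

text \<open>A flag map multiplies the bracket by \<open>d\<close> modulo the centre and its value line by \<open>m\<close>; rescaling it by
  \<open>m / d\<close> makes the two factors agree.\<close>
lemma flag_map_rescale:
  fixes A :: "'k::finite heis_space \<Rightarrow> 'k heis_space"
  assumes "heis.flag_map A"
  obtains r m where "r \<noteq> 0" "m \<noteq> 0" "r *\<^sub>R A e_z = m *\<^sub>R e_z"
    "\<And>u v. hx (r *\<^sub>R A u) * hy (r *\<^sub>R A v) - hx (r *\<^sub>R A v) * hy (r *\<^sub>R A u) = m * (hx u * hy v - hx v * hy u)"
proof -
  have lin: "linear A" and AZ: "\<And>z. A z \<in> heis.Z \<longleftrightarrow> z \<in> heis.Z" using assms unfolding heis.flag_map_def by auto
  obtain l where l: "l \<noteq> 0" "A e_z = l *\<^sub>R e_z" using assms unfolding heis.flag_map_def by blast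
  define \<alpha> \<beta> \<gamma> \<delta> where "\<alpha> = hx (A e_x)" and "\<beta> = hx (A e_y)" and "\<gamma> = hy (A e_x)" and "\<delta> = hy (A e_y)"
  note defs = \<alpha>_def \<beta>_def \<gamma>_def \<delta>_def
  have co: "hx (A u) = \<alpha> * hx u + \<beta> * hy u \<and> hy (A u) = \<gamma> * hx u + \<delta> * hy u" for u
  proof -
    have "u - hx u *\<^sub>R e_x - hy u *\<^sub>R e_y \<in> heis.Z" unfolding heis_Z by simp
    then have "A (u - hx u *\<^sub>R e_x - hy u *\<^sub>R e_y) \<in> heis.Z" using AZ by blast
    then show ?thesis unfolding heis_Z defs
      by (simp add: linear_diff[OF lin] linear_scale[OF lin] mult.commute)
  qed
  define d where "d = \<alpha> * \<delta> - \<beta> * \<gamma>"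
  have "d \<noteq> 0"
  proof
    assume d: "d = 0"
    have ker: "s = 0 \<and> t = 0" if "\<alpha> * s + \<beta> * t = 0" "\<gamma> * s + \<delta> * t = 0" for s t
    proof -
      have "A (s *\<^sub>R e_x + t *\<^sub>R e_y) \<in> heis.Z" 
        unfolding heis_Z using that co[of "s *\<^sub>R e_x + t *\<^sub>R e_y"] by simp
      then have "s *\<^sub>R e_x + t *\<^sub>R (e_y :: 'k heis_space) \<in> heis.Z" using AZ by blast
      then show ?thesis unfolding heis_Z by simp
    qed
    \<comment> \<open>With zero determinant, (\<delta>, -\<gamma>) and (\<beta>, -\<alpha>) are in
      the kernel of the matrix, so all its entries vanish. Then (1, 0) is in the kernel as
      well.\<close>
    have "\<delta> = 0 \<and> - \<gamma> = 0" "\<beta> = 0 \<and> - \<alpha> = 0"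
      using d unfolding d_def by (intro ker; simp add: algebra_simps)+
    then show False using ker[of 1 0] by simp
  qed
  show thesis
  proof
    \<comment> \<open>A factor r turns the line factor into r l and the determinant into r^2 d;
      equating them gives r = l / d, which may be negative.\<close>
    show "l / d \<noteq> 0" "(l / d) * l \<noteq> 0" using l \<open>d \<noteq> 0\<close> by auto
    show "(l / d) *\<^sub>R A e_z = ((l / d) * l) *\<^sub>R e_z" by (simp add: l)
    fix u v
    have "hx (A u) * hy (A v) - hx (A v) * hy (A u) = d * (hx u * hy v - hx v * hy u)"
      using co[of u] co[of v] unfolding d_def by (simp add: algebra_simps)
    then have "(l / d) * (l / d) * (hx (A u) * hy (A v) - hx (A v) * hy (A u)) = (l / d) * (l / d) * (d * (hx u * hy v - hx v * hy u))"
      by simp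
    also have "\<dots> = (l / d) * l * (hx u * hy v - hx v * hy u)" using \<open>d \<noteq> 0\<close> by simp
    finally show "hx ((l / d) *\<^sub>R A u) * hy ((l / d) *\<^sub>R A v) - hx ((l / d) *\<^sub>R A v) * hy ((l / d) *\<^sub>R A u)
        = (l / d) * l * (hx u * hy v - hx v * hy u)" by (simp add: algebra_simps)
  qed
qed

text \<open>Rescaling A to the derivative of an automorphism multiplies the pulled-back form by r^2.
  The scaling constant 1 / r^2 undoes this and is positive whatever the sign of r.\<close>

lemma metric_equiv_if_flag_equiv:
  assumes g1: "left_inv_metric p q g1" and g2: "left_inv_metric p q g2"
    and A: "heis.flag_map A" "\<And>u v. g1 0 u v = g2 0 (A u) (A v)"
  shows "metric_equiv g1 g2"
proof -
  obtain r m where r: "r \<noteq> 0" "m \<noteq> 0" "r *\<^sub>R A e_z = m *\<^sub>R e_z"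
    "\<And>u v. hx (r *\<^sub>R A u) * hy (r *\<^sub>R A v) - hx (r *\<^sub>R A v) * hy (r *\<^sub>R A u) = m * (hx u * hy v - hx v * hy u)"
    using flag_map_rescale[OF A(1)] by blast
  define C where "C u = r *\<^sub>R A u" for u
  have lin: "linear A" and bij: "bij A" using A(1) unfolding heis.flag_map_def by auto
  have linC: "linear C" unfolding C_def using lin by (simp add: linear_compose_scale_right)
  have bijC: "bij C"
    by (rule o_bij[of "\<lambda>u. inv A ((1 / r) *\<^sub>R u)"]) 
       (use r(1) bij in \<open>auto simp: fun_eq_iff C_def bij_is_inj bij_is_surj surj_f_inv_f\<close>)
  let ?f = "auto_of_linear m C"
  have f: "G_auto ?f" using auto_of_linear_G_auto[OF linC bijC _ r(2)] r(3,4) unfolding C_def by blast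
  have s1: "g1 a (left_trans a x) (left_trans a y) = g1 0 x y" and s2: "g2 a (left_trans a x) (left_trans a y) = g2 0 x y" for a x y
    using g1 g2 unfolding left_inv_metric_iff by blast+
  have sym: "sym_form (g2 0)" using g2 unfolding left_inv_metric_def has_signature_def by blast
  have "g1 a x y = (1 / r\<^sup>2) * g2 (?f a) (frechet_derivative ?f (at a) x) (frechet_derivative ?f (at a) y)" for a x y
  proof -
    define x' y' where "x' = left_trans (- a) x" and "y' = left_trans (- a) y"
    have xy: "x = left_trans a x'" "y = left_trans a y'" unfolding x'_def y'_def by simp_all
    have "g2 (?f a) (frechet_derivative ?f (at a) x) (frechet_derivative ?f (at a) y) = g2 0 (C x') (C y')"
      unfolding xy G_auto_derivative_left_trans[OF f] auto_of_linear_derivative_0[OF linC] s2 ..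
    also have "\<dots> = r\<^sup>2 * g1 0 x' y'" unfolding C_def A(2) by (simp add: sym_form_simps[OF sym] power2_eq_square)
    finally show ?thesis unfolding xy s1 using r(1) by simp
  qed
  moreover have "1 / r\<^sup>2 > 0" using r(1) by simp
  ultimately show ?thesis unfolding metric_equiv_def using f by blast
qed

lemma metric_equiv_imp_flag_equiv:
  assumes "metric_equiv g1 g2"
  obtains r A where "r > 0" "heis.flag_map A" "\<And>u v. g1 0 u v = r * g2 0 (A u) (A v)"
proof -
  obtain c \<phi> where c: "c > 0" "G_auto \<phi>"
    "\<And>a x y. g1 a x y = c * g2 (\<phi> a) (frechet_derivative \<phi> (at a) x) (frechet_derivative \<phi> (at a) y)"
    using assms unfolding metric_equiv_def by blast
  show thesis
    using that[OF c(1) G_auto_derivative_flag_map[OF c(2)]] c(3)[of 0] G_auto_zero[OF c(2)] by simp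
qed

lemma metric_equiv_iff_profile:
  assumes g: "left_inv_metric p q g1" "left_inv_metric p q g2" and k: "heis.profile (g1 0) k1" "heis.profile (g2 0) k2"
  shows "metric_equiv g1 g2 \<longleftrightarrow> k1 = k2"
proof
  have sig: "has_signature p q (g1 0)" "has_signature p q (g2 0)" using g unfolding left_inv_metric_iff by auto
  then have B: "sym_form (g1 0)" "nondegenerate (g1 0)" "sym_form (g2 0)" "nondegenerate (g2 0)"
    unfolding has_signature_def by auto
  {
    assume "metric_equiv g1 g2"
    then obtain r A where "r > 0" "heis.flag_map A" "\<And>u v. g1 0 u v = r * g2 0 (A u) (A v)"
      using metric_equiv_imp_flag_equiv by blast
    then have "heis.profile (g2 0) k1" using heis.profile_flag_map[OF B _ _ _ k(1)] by blast
    then show "k1 = k2" using heis.profile_unique[OF B(3,4)] k(2) by blast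
  next
    assume "k1 = k2"
    then obtain A where "heis.flag_map A" "\<And>u v. g2 0 (A u) (A v) = g1 0 u v"
      using heis.flag_isometry_exists[OF sig] k by blast
    then show "metric_equiv g1 g2" using metric_equiv_if_flag_equiv[OF g] by metis
  }
qed

section \<open>Counting\<close>

lemma card_quotient_kernel:
  "card (M // {(x, y). x \<in> M \<and> y \<in> M \<and> f x = f y}) = card (f ` M)"
proof -
  let ?R = "{(x, y). x \<in> M \<and> y \<in> M \<and> f x = f y}" and ?C = "\<lambda>v. {y \<in> M. f y = v}"
  have "M // ?R = ?C ` (f ` M)" 
  proof -
    have "?R `` {x} = ?C (f x)" if "x \<in> M" for x using that by auto
    then show ?thesis unfolding quotient_def by auto
  qed
  moreover have "inj_on ?C (f ` M)" by (rule inj_onI) blast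
  ultimately show ?thesis by (simp add: card_image)
qed

lemma num_classes_eq_card_profiles:
  assumes "CARD('k::finite) + 3 = p + q"
  shows "num_classes p q TYPE('k) = card {k. valid_profile k \<and> fits_signature p q k}"
proof -
  let ?M = "{g :: 'k Gmetric. left_inv_metric p q g}"
  \<comment> \<open>Each metric in \<open>?M\<close> has exactly one profile, so the choice is
    determined there.\<close>
  define prof where "prof g = (SOME k. heis.profile (g 0) k)" for g :: "'k Gmetric"
  have form: "has_signature p q (g 0)" "sym_form (g 0)" "nondegenerate (g 0)" if "g \<in> ?M" for g
    using that unfolding left_inv_metric_def has_signature_def by blast+
  have prof: "heis.profile (g 0) (prof g)" if "g \<in> ?M" for g
    unfolding prof_def using heis.profile_exists[OF form(2,3)[OF that]] by (metis someI_ex)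
  have "{(g1, g2). left_inv_metric p q g1 \<and> left_inv_metric p q g2 \<and> metric_equiv g1 g2}
      = {(g1, g2). g1 \<in> ?M \<and> g2 \<in> ?M \<and> prof g1 = prof g2}"
  proof -
    have "metric_equiv g1 g2 \<longleftrightarrow> prof g1 = prof g2" if "left_inv_metric p q g1" "left_inv_metric p q g2" for g1 g2
      using metric_equiv_iff_profile[OF that] prof[of g1] prof[of g2] that by blast
    then show ?thesis by blast
  qed
  then have "num_classes p q TYPE('k) = card (prof ` ?M)"
    unfolding num_classes_def by (simp only: card_quotient_kernel)
  also have "prof ` ?M = {k. valid_profile k \<and> fits_signature p q k}"
  proof
    show "prof ` ?M \<subseteq> {k. valid_profile k \<and> fits_signature p q k}"
    proof
      fix k assume "k \<in> prof ` ?M"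
      then obtain g where g: "g \<in> ?M" "k = prof g" by blast
      show "k \<in> {k. valid_profile k \<and> fits_signature p q k}"
        unfolding g(2) using heis.profile_valid[OF form(2,3)[OF g(1)] prof[OF g(1)]]
          heis.profile_fits_signature[OF form(1)[OF g(1)] prof[OF g(1)]] by blast
    qed
    have dim: "p + q = DIM('k heis_space)" using assms by simp
    show "{k. valid_profile k \<and> fits_signature p q k} \<subseteq> prof ` ?M"
    proof
      fix k assume "k \<in> {k. valid_profile k \<and> fits_signature p q k}"
      then obtain B :: "'k heis_space \<Rightarrow> 'k heis_space \<Rightarrow> real" where B: "has_signature p q B" "heis.profile B k"
        using heis.profile_realizable[OF dim] by blast
      obtain g where g: "left_inv_metric p q g" "g 0 = B" using left_inv_metric_of_form[OF B(1)] by blast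
      then have "prof g = k" using heis.profile_unique[of B] prof[of g] form[of g] B(2) by auto
      then show "k \<in> prof ` ?M" using g(1) by blast
    qed
  qed
  finally show ?thesis .
qed

text \<open>Six decreasing pairs of norms exist. Three of them contain 0 and allow the line inside
  the plane; all six combine with each of the three signs of e when it is outside, giving 3 + 18 =
  21.\<close>

definition profile_list :: "(bool \<times> real \<times> real \<times> real) list" where
  "profile_list = [(True, 0, 1, 0), (True, 0, 0, 0), (True, 0, 0, -1),
     (False, 1, 1, 1), (False, 1, 1, 0), (False, 1, 1, -1), (False, 1, 0, 0), (False, 1, 0, -1), (False, 1, -1, -1),
     (False, 0, 1, 1), (False, 0, 1, 0), (False, 0, 1, -1), (False, 0, 0, 0), (False, 0, 0, -1), (False, 0, -1, -1),
     (False, -1, 1, 1), (False, -1, 1, 0), (False, -1, 1, -1), (False, -1, 0, 0), (False, -1, 0, -1), (False, -1, -1, -1)]"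

lemma valid_profile_iff: "valid_profile k \<longleftrightarrow> k \<in> set profile_list"
proof -
  obtain c s t1 t2 where k: "k = (c, s, t1, t2)" by (metis prod_cases4)
  show ?thesis
  proof
    assume "valid_profile k"
    then have "s = -1 \<or> s = 0 \<or> s = 1" "t1 = -1 \<or> t1 = 0 \<or> t1 = 1" "t2 = -1 \<or> t2 = 0 \<or> t2 = 1" "t2 \<le> t1"
      "c \<longrightarrow> s = 0 \<and> (t1 = 0 \<or> t2 = 0)" unfolding k valid_profile_def by auto
    then show "k \<in> set profile_list" unfolding k profile_list_def by (elim disjE; cases c; simp)
  next
    assume "k \<in> set profile_list"
    then show "valid_profile k" unfolding profile_list_def by (auto simp: valid_profile_def)
  qed
qed

text \<open>With concrete norms the bounds become comparisons of numerals with p and q, so filtering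
  the list is a matter of simplification even for symbolic p and q.\<close>

lemma fits_signature_iff:
  "fits_signature p q (c, s, t1, t2) \<longleftrightarrow>
     of_bool (t1 \<ge> 0) + of_bool (t2 \<ge> 0) + of_bool (\<not> c \<and> s \<ge> 0) \<le> p \<and>
     of_bool (t1 \<le> 0) + of_bool (t2 \<le> 0) + of_bool (\<not> c \<and> s \<le> 0) \<le> q"
proof -
  have card: "card {i \<in> frame_index c. Q (frame_norm s t1 t2 i)} = of_bool (Q t1) + of_bool (Q t2) + of_bool (\<not> c \<and> Q s)" for Q
  proof -
    have card: "card {i \<in> frame_index c. Q (frame_norm s t1 t2 i)} = (\<Sum>i\<in>frame_index c. of_bool (Q (frame_norm s t1 t2 i)))"
      using finite_frame_index by (simp add: Int_def)
    then show ?thesis by (simp add: frame_index_def frame_norm_def)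
  qed
  show ?thesis unfolding fits_signature_def case_prod_conv card[of "\<lambda>t. t \<ge> 0"] card[of "\<lambda>t. t \<le> 0"] ..
qed

theorem theorem1p2:
  fixes p q :: nat
  assumes "p \<ge> 1" and "q \<ge> 1" and "p + q \<ge> 4"
    and "CARD('k::finite) = p + q - 3"
  shows "(p \<ge> 3 \<and> q \<ge> 3 \<longrightarrow> num_classes p q TYPE('k) = 21)
       \<and> (p \<ge> 3 \<and> q = 2 \<longrightarrow> num_classes p q TYPE('k) = 15)
       \<and> (p \<ge> 3 \<and> q = 1 \<longrightarrow> num_classes p q TYPE('k) = 6)
       \<and> (p = 2 \<and> q = 2 \<longrightarrow> num_classes p q TYPE('k) = 10)"
proof -
  have "{k. valid_profile k \<and> fits_signature p q k} = set (filter (fits_signature p q) profile_list)"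
    by (auto simp: valid_profile_iff)
  moreover have "distinct profile_list" unfolding profile_list_def by simp
  ultimately have "num_classes p q TYPE('k) = length (filter (fits_signature p q) profile_list)"
    using num_classes_eq_card_profiles[where 'k = 'k, of p q] assms
    by (simp add: distinct_card[symmetric] del: set_filter)
  \<comment> \<open>Each sum in the criterion is at most 3, so a bound of 3 or more never excludes a
    profile, and only the values 1 and 2 of p and q cut the list down.\<close>
  then show ?thesis unfolding profile_list_def by (auto simp: fits_signature_iff)
qed

end
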